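(* Let $\mathsf{T}$, $\mathbf{a}$, $\mathbf{p}_{\mathrm S}$ be as defined in the context, and consider the AoI process of the device whose refreshes are the slots $s$ with $X^{(s)}=\mathrm S$. Then its discretized-AoI PMF, peak-AoI PMF, average AoI and age-violation probability are $$\mathbb{P}[\widehat\Delta=\delta]=\frac{\mathbf p_{\mathrm S}^{\mathsf T}\mathsf T^{\delta-2}\mathbf 1_{2\mathrm E+2}}{\mathbf p_{\mathrm S}^{\mathsf T}(\mathsf I_{2\mathrm E+2}-\mathsf T)^{-1}\mathbf 1_{2\mathrm E+2}},\qquad \mathbb{P}[\widetilde\Delta=\delta]=\mathbf p_{\mathrm S}^{\mathsf T}\mathsf T^{\delta-2}\mathbf a,\qquad \delta=2,3,\dots,$$ $$\bar\Delta=\frac12+\frac{\mathbf p_{\mathrm S}^{\mathsf T}(\mathsf I_{2\mathrm E+2}-\mathsf T)^{-2}\mathbf 1_{2\mathrm E+2}}{\mathbf p_{\mathrm S}^{\mathsf T}(\mathsf I_{2\mathrm E+2}-\mathsf T)^{-1}\mathbf 1_{2\mathrm E+2}},$$ $$\zeta(\theta)=1-\frac{\sum_{y=1}^{\theta-1}y\,\mathbf p_{\mathrm S}^{\mathsf T}\mathsf T^{y-1}\mathbf a+(\theta-1)\,\mathbf p_{\mathrm S}^{\mathsf T}\mathsf T^{\theta-1}\mathbf 1_{2\mathrm E+2}}{\mathbf p_{\mathrm S}^{\mathsf T}(\mathsf I_{2\mathrm E+2}-\mathsf T)^{-1}\mathbf 1_{2\mathrm E+2}},\qquad \theta=1,2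,\dots$$
   Context: Setting (approximate model of one energy-harvesting device running slotted ALOHA, in which the interference from other devices is summarized by average decoding probabilities). Parameters: integer battery capacity $\mathrm E\ge1$; $\alpha\in(0,1]$; $\gamma\in(0,1]$; $\pi_{b,b_t}\in[0,1]$ for $b\in[0:\mathrm E]$, $b_t\in[0:b]$ with $\sum_{b_t=0}^b\pi_{b,b_t}=1$, and $\pi_{b,b_t}=0$ for $b_t>b$ or $b_t<0$; numbers $\bar\omega_{b_t}\in[0,1]$, $b_t\in[0:\mathrm E]$. Let $\rho_{b,b_t}=\alpha\pi_{b,b_t}+(1-\alpha)\mathbf 1\{b_t=0\}$ ($\rho_{b,b_t}=0$ for $b_t<0$). The device's state is the Markov chain $(X^{(s)},B^{(s)})$ on $\{\mathrm S,\mathrm F\}\times[0:\mathrm E]$ ($X^{(s)}=\mathrm S$ iff the AoI is refreshed in slot $s$; $B^{(s)}$ = battery level at end of slot $s$) with, for $x'\in\{\mathrm S,\mathrm F\}$, $b',b\in[0:\mathrm E]$: $\mathbb P[(x',b')\to(\mathrm S,b)]=\bar\omega_{b'-b}\rho_{b',b'-b}(1-\gamma\mathbf 1\{(b',b)\ne(\mathrm E,\mathrm E)\})+\bar\omega_{b'-b+1}\rho_{b',b'-b+1}\gamma$, $\mathbb P[(x',b')\to(\mathrm F,b)]=(1-\bar\omega_{b'-b})\rho_{b',b'-b}(1-\gamma\mathbf 1\{(b',b)\ne(\mathrm E,\mathrm E)\})+(1-\bar\omega_{b'-b+1})\rho_{b',b'-b+1}\gamma$; $(p_{(x,b)})$ is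 its steady-state distribution. $\mathbf p_{\mathrm S}=\big((p_{(\mathrm S,0)},\dots,p_{(\mathrm S,\mathrm E)})/\sum_{i}p_{(\mathrm S,i)},\mathbf 0_{\mathrm E+1}\big)$. With states ordered $(\mathrm S',0),\dots,(\mathrm S',\mathrm E),(\mathrm F,0),\dots,(\mathrm F,\mathrm E)$ ($(\mathrm S',b)$ having the outgoing transitions of $(\mathrm S,b)$), $\mathsf T$ is the $(2\mathrm E+2)\times(2\mathrm E+2)$ matrix with $\mathsf T[(x',b'),(\mathrm F,b)]=\mathbb P[(x',b')\to(\mathrm F,b)]$, $\mathsf T[(x',b'),(\mathrm S',b)]=0$, and $\mathbf a[(x',b')]=\sum_b\mathbb P[(x',b')\to(\mathrm S,b)]$. AoI metrics (time is slotted, slot length $1$): the AoI is reset to $1$ at the end of each refresh slot and grows linearly with slope $1$ otherwise; with refresh slots $s_0<s_1<\dots$, the discretized AoI at the end of slot $s\in\{s_{i-1}+1,\dots,s_i\}$ is $s-s_{i-1}+1$ and the peak AoI of the $i$th period is $s_i-s_{i-1}+1$; $\mathbb P[\widehat\Delta=\delta]$ and $\mathbb P[\widetilde\Delta=\delta]$ are the long-run fractions of slots, resp. of inter-refresh periods, in which these equal $\delta$; $\bar\Delta$ is the long-run time average of the AoI and $\zeta(\theta)$ the long-run fraction of time during which the AoI exceeds $\theta$. $\mathsf I_m$ is the identity, $\mathbf 1_m$ the all-ones vector. *)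

theory Defs
  imports "HOL-Probability.Probability" "Jordan_Normal_Form.Matrix"
begin

datatype xstate = XS | XF   (* XS: AoI refreshed in the slot; XF: not refreshed *)

type_synonym state = "xstate \<times> nat"

definition states :: "nat \<Rightarrow> state set" where
  "states E = UNIV \<times> {0..E}"

definition rho :: "real \<Rightarrow> (nat \<Rightarrow> nat \<Rightarrow> real) \<Rightarrow> nat \<Rightarrow> int \<Rightarrow> real" where
  "rho \<alpha> \<pi> b bt = (if bt < 0 then 0
      else \<alpha> * \<pi> b (nat bt) + (1 - \<alpha>) * (if bt = 0 then 1 else 0))"

definition notEE :: "nat \<Rightarrow> nat \<Rightarrow> nat \<Rightarrow> real" where
  "notEE E b' b = (if (b', b) \<noteq> (E, E) then 1 else 0)"

definition trans :: "nat \<Rightarrow> real \<Rightarrow> real \<Rightarrow> (nat \<Rightarrow> nat \<Rightarrow> real) \<Rightarrow> (nat \<Rightarrow> real)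
                     \<Rightarrow> state \<Rightarrow> state \<Rightarrow> real" where
  "trans E \<alpha> \<gamma> \<pi> \<omega> s' s =
     (let b' = snd s'; b = snd s; k = int b' - int b;
          w0 = (if k < 0 then 0 else \<omega> (nat k)); w1 = \<omega> (nat (k + 1)) in
      (case fst s of
         XS \<Rightarrow> w0 * rho \<alpha> \<pi> b' k * (1 - \<gamma> * notEE E b' b)
               + w1 * rho \<alpha> \<pi> b' (k + 1) * \<gamma>
       | XF \<Rightarrow> (1 - w0) * rho \<alpha> \<pi> b' k * (1 - \<gamma> * notEE E b' b)
               + (1 - w1) * rho \<alpha> \<pi> b' (k + 1) * \<gamma>))"

definition stationary :: "nat \<Rightarrow> (state \<Rightarrow> state \<Rightarrow> real) \<Rightarrow> (state \<Rightarrow> real) \<Rightarrow> bool" where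
  "stationary E P q \<longleftrightarrow>
     (\<forall>s\<in>states E. q s \<ge> 0) \<and> (\<Sum>s\<in>states E. q s) = 1 \<and>
     (\<forall>s\<in>states E. q s = (\<Sum>s'\<in>states E. q s' * P s' s))"

definition idx_state :: "nat \<Rightarrow> nat \<Rightarrow> state" where
  "idx_state E i = (if i \<le> E then (XS, i) else (XF, i - (E + 1)))"

definition Tmat :: "nat \<Rightarrow> (state \<Rightarrow> state \<Rightarrow> real) \<Rightarrow> real mat" where
  "Tmat E P = mat (2*E+2) (2*E+2)
     (\<lambda>(i, j). if j \<le> E then 0 else P (idx_state E i) (XF, j - (E + 1)))"

definition avec :: "nat \<Rightarrow> (state \<Rightarrow> state \<Rightarrow> real) \<Rightarrow> real vec" where
  "avec E P = vec (2*E+2) (\<lambda>i. \<Sum>b\<le>E. P (idx_state E i) (XS, b))"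

definition pSvec :: "nat \<Rightarrow> (state \<Rightarrow> real) \<Rightarrow> real vec" where
  "pSvec E p = vec (2*E+2)
     (\<lambda>i. if i \<le> E then p (XS, i) / (\<Sum>b\<le>E. p (XS, b)) else 0)"

definition ones :: "nat \<Rightarrow> real vec" where
  "ones n = vec n (\<lambda>_. 1)"

(* the inverse of a square matrix (meaningful when invertible_mat A) *)
definition minv :: "real mat \<Rightarrow> real mat" where
  "minv A = (SOME B. B \<in> carrier_mat (dim_row A) (dim_row A) \<and> inverts_mat A B \<and> inverts_mat B A)"

section \<open>AoI along a sample path x :: nat => state (slot s = time interval [s, s+1))\<close>

definition refresh :: "(nat \<Rightarrow> state) \<Rightarrow> nat \<Rightarrow> bool" where
  "refresh x s \<longleftrightarrow> fst (x s) = XS"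

(* discretized AoI at the end of slot s: s - s_{i-1} + 1, where s_{i-1} is the last refresh
   slot strictly before s; undefined (None) before the first refresh *)
definition disc_aoi :: "(nat \<Rightarrow> state) \<Rightarrow> nat \<Rightarrow> nat option" where
  "disc_aoi x s = (if \<exists>r<s. refresh x r
      then Some (s - Max {r. r < s \<and> refresh x r} + 1) else None)"

(* continuous-time AoI: reset to 1 at the end (time r+1) of each refresh slot r, slope 1;
   set to 0 before the first refresh *)
definition cont_aoi :: "(nat \<Rightarrow> state) \<Rightarrow> real \<Rightarrow> real" where
  "cont_aoi x t = (if \<exists>r. real r + 1 \<le> t \<and> refresh x r
      then t - real (Max {r. real r + 1 \<le> t \<and> refresh x r}) else 0)"

definition disc_frac :: "(nat \<Rightarrow> state) \<Rightarrow> nat \<Rightarrow> nat \<Rightarrow> real" where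
  "disc_frac x \<delta> N = real (card {s. s < N \<and> disc_aoi x s = Some \<delta>}) / real N"

(* fraction of (completed) inter-refresh periods, among those ending before N,
   whose peak AoI s_i - s_{i-1} + 1 equals delta *)
definition peak_frac :: "(nat \<Rightarrow> state) \<Rightarrow> nat \<Rightarrow> nat \<Rightarrow> real" where
  "peak_frac x \<delta> N =
     real (card {s. s < N \<and> refresh x s \<and> disc_aoi x s = Some \<delta>})
     / real (card {s. s < N \<and> refresh x s \<and> disc_aoi x s \<noteq> None})"

definition avg_aoi :: "(nat \<Rightarrow> state) \<Rightarrow> real \<Rightarrow> real" where
  "avg_aoi x \<tau> = integral {0..\<tau>} (cont_aoi x) / \<tau>"

definition viol_frac :: "(nat \<Rightarrow> state) \<Rightarrow> real \<Rightarrow> real \<Rightarrow> real" where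
  "viol_frac x \<theta> \<tau> = integral {0..\<tau>} (\<lambda>t. if cont_aoi x t > \<theta> then 1 else 0) / \<tau>"

end

theory Submission
  imports Defs "HOL-Library.Discrete_Functions" "Jordan_Normal_Form.Determinant"
begin

text \<open>
  Every functional of the history minus its one-step prediction is a sequence of orthogonal
  differences, so its time average tends to \<open>0\<close> almost surely as soon as it is bounded in \<open>L\<^sup>2\<close>.
  For indicators of states this says that the empirical distribution is asymptotically stationary;
  by compactness and uniqueness it converges to \<open>p\<close>. For indicators of the age it expresses the
  frequency of age \<open>\<delta> + 1\<close> through that of age \<open>\<delta>\<close>, which produces the powers of \<open>T\<close>. For the mean
  age, which is unbounded, one uses the functional \<open>age * (1 + g)\<close> off the refresh states, where
  \<open>g = (I - T)\<^sup>-\<^sup>1 1\<close> is the expected time to the next refresh; it solves the Poisson equation of the age,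
  and the drift of \<open>age\<^sup>2 * g\<close> bounds the second moments. The matrix \<open>I - T\<close> is invertible since a
  refresh is reachable from every state, again by uniqueness of \<open>p\<close>. Stationarity gives
  \<open>p\<^sub>S (I - T)\<^sup>-\<^sup>1 1 = 1 / P(S)\<close>, which is Kac's formula.
\<close>

section \<open>A strong law for orthogonal variables\<close>

text \<open>Uniqueness of \<open>p\<close> is the only ergodicity at hand: the chain may be
  periodic, may have transient states and starts from an arbitrary law \<open>\<mu>0\<close>. The
  n-step laws need not converge, so everything is phrased through Cesaro means. Orthogonality in L2
  suits this setting because a history of fixed length takes finitely many values: expectations are
  finite sums of path weights, and conditional expectation is the explicit sum
  \<open>predict\<close>. Second moments are what both error terms ask for: the law for orthogonal
  differences, and the boundary term \<open>\<phi> (hist N) / N\<close> that appears when the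
  functional and its prediction are aligned at the same slot. The mean age comes out as the
  stationary mean of \<open>g\<close> plus 1, the 1 being Kac's formula applied to a correction on
  refresh states. A slot whose discretized age is a contributes \<open>a - 1/2\<close> to the
  integral of the continuous age, whence the 1/2 in the final formula.\<close>

lemma AE_tendsto_0_if_summable_integral:
  fixes Z :: "nat \<Rightarrow> 'w \<Rightarrow> real"
  assumes int: "\<And>k. integrable M (Z k)" and nonneg: "\<And>k w. Z k w \<ge> 0"
    and sm: "summable (\<lambda>k. \<integral>w. Z k w \<partial>M)"
  shows "AE w in M. (\<lambda>k. Z k w) \<longlonglongrightarrow> 0"
proof -
  have [measurable]: "\<And>k. Z k \<in> borel_measurable M" using int by auto
  have "(\<integral>\<^sup>+ w. (\<Sum>k. ennreal (Z k w)) \<partial>M) = (\<Sum>k. \<integral>\<^sup>+ w. ennreal (Z k w) \<partial>M)"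
    by (rule nn_integral_suminf) measurable
  also have "\<dots> = (\<Sum>k. ennreal (\<integral>w. Z k w \<partial>M))"
    using int nonneg by (simp add: nn_integral_eq_integral)
  also have "\<dots> = ennreal (\<Sum>k. \<integral>w. Z k w \<partial>M)"
    using sm nonneg by (intro suminf_ennreal2) auto
  finally have "(\<integral>\<^sup>+ w. (\<Sum>k. ennreal (Z k w)) \<partial>M) \<noteq> \<infinity>" by simp
  then have "AE w in M. (\<Sum>k. ennreal (Z k w)) \<noteq> \<infinity>"
    by (intro nn_integral_PInf_AE) auto
  then show ?thesis
  proof eventually_elim
    case (elim w)
    then have "summable (\<lambda>k. Z k w)"
      using nonneg by (intro summable_suminf_not_top) auto
    then show ?case by (rule summable_LIMSEQ_zero)
  qed
qed

lemma sum_between_squares_le: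
  fixes d :: "nat \<Rightarrow> real"
  assumes "k\<^sup>2 \<le> N" "N < (Suc k)\<^sup>2"
  shows "\<bar>\<Sum>s<N. d s\<bar> \<le> \<bar>\<Sum>s<k\<^sup>2. d s\<bar> + (\<Sum>s\<in>{k\<^sup>2..<(Suc k)\<^sup>2}. \<bar>d s\<bar>)"
proof -
  have "{..<N} = {..<k\<^sup>2} \<union> {k\<^sup>2..<N}" using assms by auto
  then have "(\<Sum>s<N. d s) = (\<Sum>s<k\<^sup>2. d s) + (\<Sum>s\<in>{k\<^sup>2..<N}. d s)"
    by (simp add: sum.union_disjoint ivl_disj_int)
  moreover have "\<bar>\<Sum>s\<in>{k\<^sup>2..<N}. d s\<bar> \<le> (\<Sum>s\<in>{k\<^sup>2..<N}. \<bar>d s\<bar>)" by (rule sum_abs)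
  moreover have "\<dots> \<le> (\<Sum>s\<in>{k\<^sup>2..<(Suc k)\<^sup>2}. \<bar>d s\<bar>)"
    using assms by (intro sum_mono2) auto
  ultimately show ?thesis by linarith
qed

text \<open>Chebyshev along the squares; the blocks between consecutive squares are short
  enough to be controlled by their absolute sums.\<close>

lemma orthogonal_strong_law:
  fixes d :: "nat \<Rightarrow> 'w \<Rightarrow> real"
  assumes int2: "\<And>s t. integrable M (\<lambda>w. d s w * d t w)"
    and meas [measurable]: "\<And>s. d s \<in> borel_measurable M"
    and bnd: "\<And>s. (\<integral>w. (d s w)\<^sup>2 \<partial>M) \<le> C"
    and orth: "\<And>s t. s \<noteq> t \<Longrightarrow> (\<integral>w. d s w * d t w \<partial>M) = 0"
  shows "AE w in M. (\<lambda>N. (\<Sum>s<N. d s w) / real N) \<longlonglongrightarrow> 0"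
proof -
  have C0: "C \<ge> 0" using bnd[of 0] by (rule order_trans[rotated]) (rule integral_nonneg_AE, simp)
  define S where "S k w = (\<Sum>s<k\<^sup>2. d s w)" for k w
  define G where "G k w = (\<Sum>s\<in>{k\<^sup>2..<(Suc k)\<^sup>2}. \<bar>d s w\<bar>)" for k w
  define B where "B k w = (\<Sum>s\<in>{k\<^sup>2..<(Suc k)\<^sup>2}. (d s w)\<^sup>2)" for k w
  \<comment> \<open>One variable controls both the partial sum at \<open>k^2\<close> and the block
    up to the next square. By Cauchy-Schwarz over the \<open>2k + 1\<close> terms of the block,
    \<open>(2k + 1) * B k\<close> dominates \<open>(G k)^2\<close>. Both pieces have mean of order
    \<open>k^2\<close>, so dividing by \<open>k^4\<close> leaves the summable
    \<open>1/k^2\<close>.\<close>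
  define Z where "Z k w = ((S k w)\<^sup>2 + (2 * real k + 1) * B k w) / real k ^ 4" for k w
  have S2: "(S k w)\<^sup>2 = (\<Sum>s<k\<^sup>2. \<Sum>t<k\<^sup>2. d s w * d t w)" for k w
    unfolding S_def power2_eq_square by (simp add: sum_product)
  have intS: "integrable M (\<lambda>w. (S k w)\<^sup>2)" for k
    unfolding S2 by (intro Bochner_Integration.integrable_sum int2)
  have ES: "(\<integral>w. (S k w)\<^sup>2 \<partial>M) \<le> (real k)\<^sup>2 * C" for k
  proof -
    have "(\<integral>w. (S k w)\<^sup>2 \<partial>M) = (\<Sum>s<k\<^sup>2. \<Sum>t<k\<^sup>2. \<integral>w. d s w * d t w \<partial>M)"
      unfolding S2 by (subst Bochner_Integration.integral_sum; (intro Bochner_Integration.integrable_sum int2 sum.cong refl)?)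
         (intro sum.cong refl Bochner_Integration.integral_sum int2)
    also have "\<dots> = (\<Sum>s<k\<^sup>2. \<Sum>t<k\<^sup>2. if t = s then \<integral>w. (d s w)\<^sup>2 \<partial>M else 0)"
      by (intro sum.cong refl) (auto simp: orth power2_eq_square)
    also have "\<dots> = (\<Sum>s<k\<^sup>2. \<integral>w. (d s w)\<^sup>2 \<partial>M)" by (simp add: sum.delta)
    also have "\<dots> \<le> (\<Sum>s<k\<^sup>2. C)" by (intro sum_mono bnd)
    finally show ?thesis by simp
  qed
  have int1: "integrable M (\<lambda>w. (d s w)\<^sup>2)" for s using int2[of s s] by (simp add: power2_eq_square)
  have intB: "integrable M (B k)" for k
    unfolding B_def by (intro Bochner_Integration.integrable_sum int1)
  have cd: "card {k\<^sup>2..<(Suc k)\<^sup>2} = 2 * k + 1" for k by (simp add: power2_eq_square)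
  have EB: "(\<integral>w. B k w \<partial>M) \<le> (2 * real k + 1) * C" for k
  proof -
    have "(\<integral>w. B k w \<partial>M) = (\<Sum>s\<in>{k\<^sup>2..<(Suc k)\<^sup>2}. \<integral>w. (d s w)\<^sup>2 \<partial>M)"
      unfolding B_def by (intro Bochner_Integration.integral_sum int1)
    also have "\<dots> \<le> (\<Sum>s\<in>{k\<^sup>2..<(Suc k)\<^sup>2}. C)" by (intro sum_mono bnd)
    also have "\<dots> = (2 * real k + 1) * C" unfolding sum_constant cd by simp
    finally show ?thesis .
  qed
  have GB: "(G k w)\<^sup>2 \<le> (2 * real k + 1) * B k w" for k w
  proof -
    have "(G k w)\<^sup>2 \<le> real (card {k\<^sup>2..<(Suc k)\<^sup>2}) * B k w"
      using Cauchy_Schwarz_ineq_sum[of "\<lambda>_. 1" "\<lambda>s. \<bar>d s w\<bar>" "{k\<^sup>2..<(Suc k)\<^sup>2}"]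
      unfolding G_def B_def by simp
    then show ?thesis unfolding cd by (simp add: add.commute)
  qed
  have B0: "B k w \<ge> 0" for k w unfolding B_def by (intro sum_nonneg) auto
  have intZ: "integrable M (Z k)" for k
    unfolding Z_def by (intro integrable_divide_zero Bochner_Integration.integrable_add integrable_mult_right intS intB)
  \<comment> \<open>10 = 1 + 9, the 9 from \<open>2k + 1 \<le> 3k\<close> for
    \<open>k \<ge> 1\<close>; at \<open>k = 0\<close> both sides are 0 by division by zero.\<close>
  have EZ: "(\<integral>w. Z k w \<partial>M) \<le> 10 * C * (1 / (real k)\<^sup>2)" for k
  proof (cases "k = 0")
    case True then show ?thesis by (simp add: Z_def)
  next
    case False
    have "(\<integral>w. Z k w \<partial>M) = ((\<integral>w. (S k w)\<^sup>2 \<partial>M) + (2 * real k + 1) * (\<integral>w. B k w \<partial>M)) / real k ^ 4"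
      unfolding Z_def using intS intB by simp
    also have "\<dots> \<le> ((real k)\<^sup>2 * C + (2 * real k + 1) * ((2 * real k + 1) * C)) / real k ^ 4"
      by (intro divide_right_mono add_mono mult_left_mono ES EB) auto
    also have "\<dots> \<le> (10 * (real k)\<^sup>2 * C) / real k ^ 4"
    proof (intro divide_right_mono)
      have "1 \<le> real k" using False by simp
      then have "(2 * real k + 1) * (2 * real k + 1) \<le> (3 * real k) * (3 * real k)"
        by (intro mult_mono) auto
      then have "(2 * real k + 1) * (2 * real k + 1) * C \<le> (9 * (real k)\<^sup>2) * C"
        by (intro mult_right_mono C0) (simp add: power2_eq_square)
      then show "(real k)\<^sup>2 * C + (2 * real k + 1) * ((2 * real k + 1) * C) \<le> 10 * (real k)\<^sup>2 * C"
        by (simp add: algebra_simps)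
    qed auto
    also have "\<dots> = 10 * C * (1 / (real k)\<^sup>2)"
      using False by (simp add: field_simps power2_eq_square power4_eq_xxxx)
    finally show ?thesis .
  qed
  have Z0: "Z k w \<ge> 0" for k w unfolding Z_def using B0 by auto
  have "summable (\<lambda>k. \<integral>w. Z k w \<partial>M)"
  proof (rule summable_comparison_test)
    show "\<exists>N. \<forall>n\<ge>N. norm (\<integral>w. Z n w \<partial>M) \<le> 10 * C * (1 / (real n)\<^sup>2)"
      using EZ Z0 by (auto simp: integral_nonneg_AE)
    show "summable (\<lambda>n. 10 * C * (1 / (real n)\<^sup>2))"
      using inverse_power_summable[of 2, where ?'a=real]
      by (intro summable_mult) (simp add: field_simps)
  qed
  with intZ Z0 have "AE w in M. (\<lambda>k. Z k w) \<longlonglongrightarrow> 0"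
    by (rule AE_tendsto_0_if_summable_integral)
  then show ?thesis
  proof eventually_elim
    case (elim w)
    have fs: "filterlim floor_sqrt at_top sequentially"
      unfolding filterlim_at_top
    proof
      fix Z show "\<forall>\<^sub>F x in sequentially. Z \<le> floor_sqrt x"
        using eventually_ge_at_top[of "Z\<^sup>2"] by eventually_elim (rule le_floor_sqrtI)
    qed
    have "(\<lambda>N. 2 * sqrt (Z (floor_sqrt N) w)) \<longlonglongrightarrow> 2 * sqrt 0"
      by (intro tendsto_intros filterlim_compose[OF elim fs])
    then have lim: "(\<lambda>N. 2 * sqrt (Z (floor_sqrt N) w)) \<longlonglongrightarrow> 0" by simp
    show ?case
    proof (rule Lim_null_comparison[OF _ lim], rule eventually_sequentiallyI)
      fix N :: nat assume "1 \<le> N"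
      define k where "k = floor_sqrt N"
      have k: "k\<^sup>2 \<le> N" "N < (Suc k)\<^sup>2" unfolding k_def by (simp_all add: floor_sqrt_power2_le Suc_floor_sqrt_power2_gt)
      have kp: "k > 0" using \<open>1 \<le> N\<close> unfolding k_def by simp
      have r4: "sqrt (real k ^ 4) = (real k)\<^sup>2" by (rule real_sqrt_unique) auto
      have "\<bar>S k w\<bar> \<le> sqrt (Z k w) * (real k)\<^sup>2"
      proof -
        have "(S k w)\<^sup>2 \<le> Z k w * real k ^ 4" unfolding Z_def using kp B0 by simp
        then have "sqrt ((S k w)\<^sup>2) \<le> sqrt (Z k w * real k ^ 4)" by (rule real_sqrt_le_mono)
        then show ?thesis by (simp add: real_sqrt_mult r4)
      qed
      moreover have G0: "G k w \<ge> 0" unfolding G_def by (intro sum_nonneg) auto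
      moreover have "G k w \<le> sqrt (Z k w) * (real k)\<^sup>2"
      proof -
        have "(G k w)\<^sup>2 \<le> Z k w * real k ^ 4" unfolding Z_def using kp GB[of k w] by (simp add: add_increasing)
        then have "sqrt ((G k w)\<^sup>2) \<le> sqrt (Z k w * real k ^ 4)" by (rule real_sqrt_le_mono)
        then show ?thesis using G0 by (simp add: real_sqrt_mult r4)
      qed
      moreover have "\<bar>\<Sum>s<N. d s w\<bar> \<le> \<bar>S k w\<bar> + G k w"
        unfolding S_def G_def by (rule sum_between_squares_le[OF k])
      ultimately have "\<bar>\<Sum>s<N. d s w\<bar> \<le> 2 * sqrt (Z k w) * (real k)\<^sup>2" by linarith
      also have "\<dots> \<le> 2 * sqrt (Z k w) * real N"
        using k(1) Z0[of k w] by (intro mult_left_mono) (auto simp flip: of_nat_power)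
      finally show "norm ((\<Sum>s<N. d s w) / real N) \<le> 2 * sqrt (Z (floor_sqrt N) w)"
        using \<open>1 \<le> N\<close> by (simp add: k_def field_simps)
    qed
  qed
qed

section \<open>Finite chains with a unique stationary distribution\<close>

text \<open>Bolzano-Weierstrass one coordinate at a time: each further extraction keeps the
  coordinates that already converge.\<close>

lemma convergent_subseq_finite:
  fixes f :: "nat \<Rightarrow> 's \<Rightarrow> real"
  assumes "finite A" and "\<And>x. x \<in> A \<Longrightarrow> bounded (range (\<lambda>n. f n x))"
  shows "\<exists>r. strict_mono r \<and> (\<forall>x\<in>A. convergent (\<lambda>n. f (r n) x))"
  using assms
proof (induction A rule: finite_induct)
  case empty
  then show ?case using strict_mono_id by blast
next
  case (insert a A)
  then obtain r where r: "strict_mono r" "\<forall>x\<in>A. convergent (\<lambda>n. f (r n) x)" by auto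
  have "bounded (range (\<lambda>n. f (r n) a))"
    by (rule bounded_subset[OF insert.prems[of a]]) auto
  from bounded_imp_convergent_subsequence[OF this]
  obtain l r' where r': "strict_mono (r' :: nat \<Rightarrow> nat)" "((\<lambda>n. f (r n) a) \<circ> r') \<longlonglongrightarrow> l"
    by metis
  have "convergent (\<lambda>n. f ((r \<circ> r') n) x)" if "x \<in> insert a A" for x
  proof (cases "x = a")
    case True
    then show ?thesis using r'(2) by (auto simp: convergent_def o_def)
  next
    case False
    then have "convergent (\<lambda>n. f (r n) x)" using r that by auto
    from convergent_subseq_convergent[OF this r'(1)] show ?thesis by (simp add: o_def)
  qed
  then show ?case using strict_mono_o[OF r(1) r'(1)] by blast
qed

text \<open>Ergodicity enters only through \<open>p_unique\<close>, which still allows periodicity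
  and transient states. Together with \<open>p_R_pos\<close> it forces a refresh to be reachable
  from every state.\<close>

locale refreshing_chain =
  fixes S :: "'s set" and P :: "'s \<Rightarrow> 's \<Rightarrow> real" and R :: "'s set" and p :: "'s \<Rightarrow> real"
  assumes finite_S: "finite S" and R_subset: "R \<subseteq> S"
    and P_nonneg: "\<And>x y. x \<in> S \<Longrightarrow> y \<in> S \<Longrightarrow> 0 \<le> P x y"
    and P_sum: "\<And>x. x \<in> S \<Longrightarrow> (\<Sum>y\<in>S. P x y) = 1"
    and p_sum: "(\<Sum>x\<in>S. p x) = 1"
    and p_stationary: "\<And>y. y \<in> S \<Longrightarrow> p y = (\<Sum>x\<in>S. p x * P x y)"
    and p_unique: "\<And>q y. (\<And>x. x \<in> S \<Longrightarrow> 0 \<le> q x) \<Longrightarrow> (\<Sum>x\<in>S. q x) = 1 \<Longrightarrow>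
        (\<And>y. y \<in> S \<Longrightarrow> q y = (\<Sum>x\<in>S. q x * P x y)) \<Longrightarrow> y \<in> S \<Longrightarrow> q y = p y"
    and p_R_pos: "0 < (\<Sum>x\<in>R. p x)"
begin

lemma S_nonempty: "S \<noteq> {}"
  using p_sum by auto

definition step :: "('s \<Rightarrow> real) \<Rightarrow> 's \<Rightarrow> real" where
  "step f x = (\<Sum>y\<in>S. P x y * f y)"

text \<open>The chain killed at refreshes: the paper's matrix \<open>T\<close>.\<close>

definition avoid :: "('s \<Rightarrow> real) \<Rightarrow> 's \<Rightarrow> real" where
  "avoid f x = (\<Sum>y\<in>S - R. P x y * f y)"

text \<open>If a coordinate stayed away from \<open>p\<close> along a subsequence, a convergent
  sub-subsequence would have a stationary limit different from \<open>p\<close>. Applied to averaged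
  n-step laws for reachability and to empirical frequencies along a path.\<close>

lemma almost_stationary_imp_tendsto:
  fixes f :: "nat \<Rightarrow> 's \<Rightarrow> real"
  assumes nonneg: "\<And>N x. x \<in> S \<Longrightarrow> 0 \<le> f N x"
    and total: "\<And>N. (\<Sum>x\<in>S. f N x) = 1"
    and almost: "\<And>y. y \<in> S \<Longrightarrow> (\<lambda>N. f N y - (\<Sum>x\<in>S. f N x * P x y)) \<longlonglongrightarrow> 0"
    and y: "y \<in> S"
  shows "(\<lambda>N. f N y) \<longlonglongrightarrow> p y"
proof (rule ccontr)
  assume "\<not> (\<lambda>N. f N y) \<longlonglongrightarrow> p y"
  then obtain \<epsilon> where e: "\<epsilon> > 0" "\<exists>\<^sub>F N in sequentially. \<not> dist (f N y) (p y) < \<epsilon>"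
    unfolding tendsto_iff frequently_def by auto
  then have "infinite {N. \<not> dist (f N y) (p y) < \<epsilon>}"
    using frequently_cofinite[of "\<lambda>N. \<not> dist (f N y) (p y) < \<epsilon>"] by (simp add: cofinite_eq_sequentially)
  from infinite_enumerate[OF this]
  obtain r :: "nat \<Rightarrow> nat" where r: "strict_mono r" "\<And>N. \<not> dist (f (r N) y) (p y) < \<epsilon>"
    unfolding mem_Collect_eq by blast
  have le1: "f N x \<le> 1" if "x \<in> S" for N x
    using member_le_sum[of x S "f N"] that nonneg finite_S unfolding total by auto
  have "bounded (range (\<lambda>n. f (r n) x))" if "x \<in> S" for x
    unfolding bounded_iff using nonneg[OF that] le1[OF that] by (intro exI[of _ 1]) auto
  from convergent_subseq_finite[of S "\<lambda>n. f (r n)", OF finite_S this]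
  obtain r' :: "nat \<Rightarrow> nat" where r': "strict_mono r'" "\<forall>x\<in>S. convergent (\<lambda>n. f (r (r' n)) x)" by auto
  define q where "q x = lim (\<lambda>n. f (r (r' n)) x)" for x
  have q: "(\<lambda>n. f (r (r' n)) x) \<longlonglongrightarrow> q x" if "x \<in> S" for x
    using r'(2) that unfolding q_def by (simp add: convergent_LIMSEQ_iff)
  have "q y = p y"
  proof (rule p_unique[OF _ _ _ y])
    show "0 \<le> q x" if "x \<in> S" for x
      by (rule LIMSEQ_le_const[OF q[OF that]]) (use nonneg[OF that] in blast)
    have "(\<lambda>n. \<Sum>x\<in>S. f (r (r' n)) x) \<longlonglongrightarrow> (\<Sum>x\<in>S. q x)" by (intro tendsto_sum q)
    then show "(\<Sum>x\<in>S. q x) = 1" by (simp add: total LIMSEQ_const_iff)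
    show "q z = (\<Sum>x\<in>S. q x * P x z)" if z: "z \<in> S" for z
    proof -
      have 1: "(\<lambda>n. f (r (r' n)) z - (\<Sum>x\<in>S. f (r (r' n)) x * P x z)) \<longlonglongrightarrow> q z - (\<Sum>x\<in>S. q x * P x z)"
        by (intro tendsto_intros q z)
      have "(\<lambda>n. f ((r \<circ> r') n) z - (\<Sum>x\<in>S. f ((r \<circ> r') n) x * P x z)) \<longlonglongrightarrow> 0"
        using LIMSEQ_subseq_LIMSEQ[OF almost[OF z] strict_mono_o[OF r(1) r'(1)]] by (simp add: o_def)
      with 1 have "q z - (\<Sum>x\<in>S. q x * P x z) = 0" by (intro LIMSEQ_unique) (simp_all add: o_def)
      then show ?thesis by simp
    qed
  qed
  with q[OF y] have "(\<lambda>n. f (r (r' n)) y) \<longlonglongrightarrow> p y" by simp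
  then have "\<forall>\<^sub>F n in sequentially. dist (f (r (r' n)) y) (p y) < \<epsilon>"
    using e(1) unfolding tendsto_iff by blast
  then show False using r(2) by simp
qed

section \<open>Algebra and order of the transition operator and of its killed version\<close>

lemma step_mono: "(\<And>y. y \<in> S \<Longrightarrow> f y \<le> g y) \<Longrightarrow> x \<in> S \<Longrightarrow> step f x \<le> step g x"
  unfolding step_def by (intro sum_mono mult_left_mono P_nonneg)

lemma step_const: "x \<in> S \<Longrightarrow> step (\<lambda>_. c) x = c"
  unfolding step_def by (simp add: P_sum flip: sum_distrib_right)

lemma avoid_mono: "(\<And>y. y \<in> S \<Longrightarrow> f y \<le> g y) \<Longrightarrow> x \<in> S \<Longrightarrow> avoid f x \<le> avoid g x"
  unfolding avoid_def by (intro sum_mono mult_left_mono P_nonneg) auto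

lemma step_cong: "(\<And>y. y \<in> S \<Longrightarrow> f y = g y) \<Longrightarrow> step f x = step g x"
  unfolding step_def by (intro sum.cong) auto

lemma avoid_cong: "(\<And>y. y \<in> S \<Longrightarrow> f y = g y) \<Longrightarrow> avoid f x = avoid g x"
  unfolding avoid_def by (intro sum.cong) auto

lemma avoid_funpow_cong:
  "(\<And>y. y \<in> S \<Longrightarrow> f y = g y) \<Longrightarrow> x \<in> S \<Longrightarrow> (avoid ^^ n) f x = (avoid ^^ n) g x"
proof (induction n arbitrary: x)
  case (Suc n)
  then show ?case by (auto intro: avoid_cong)
qed simp

lemma step_split: "step f x = avoid f x + (\<Sum>y\<in>R. P x y * f y)"
  unfolding step_def avoid_def using R_subset finite_S by (subst sum.subset_diff) auto

lemma avoid_funpow_mono: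
  "(\<And>y. y \<in> S \<Longrightarrow> f y \<le> g y) \<Longrightarrow> x \<in> S \<Longrightarrow> (avoid ^^ n) f x \<le> (avoid ^^ n) g x"
  by (induction n arbitrary: x) (auto intro: avoid_mono)

lemma avoid_cmult: "avoid (\<lambda>x. c * f x) = (\<lambda>x. c * avoid f x)"
  unfolding avoid_def by (simp add: sum_distrib_left mult.left_commute)

lemma avoid_diff: "avoid (\<lambda>x. f x - g x) = (\<lambda>x. avoid f x - avoid g x)"
  unfolding avoid_def by (simp add: sum_subtractf right_diff_distrib)

lemma avoid_funpow_cmult: "(avoid ^^ n) (\<lambda>x. c * f x) = (\<lambda>x. c * (avoid ^^ n) f x)"
  by (induction n) (simp_all add: avoid_cmult)

lemma avoid_funpow_diff: "(avoid ^^ n) (\<lambda>x. f x - g x) = (\<lambda>x. (avoid ^^ n) f x - (avoid ^^ n) g x)"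
  by (induction n) (simp_all add: avoid_diff)

lemma avoid_zero [simp]: "avoid (\<lambda>_. 0) = (\<lambda>_. 0)"
  by (auto simp: avoid_def fun_eq_iff)

lemma avoid_funpow_nonneg:
  assumes "\<And>y. y \<in> S \<Longrightarrow> 0 \<le> f y" "x \<in> S"
  shows "0 \<le> (avoid ^^ n) f x"
proof -
  have "(avoid ^^ n) (\<lambda>_. 0) x \<le> (avoid ^^ n) f x" by (rule avoid_funpow_mono) (use assms in auto)
  moreover have "(avoid ^^ n) (\<lambda>_. 0) = (\<lambda>_. 0)" by (induction n) auto
  ultimately show ?thesis by simp
qed

lemma avoid_nonneg: "(\<And>y. y \<in> S \<Longrightarrow> 0 \<le> f y) \<Longrightarrow> x \<in> S \<Longrightarrow> 0 \<le> avoid f x"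
  using avoid_funpow_nonneg[of f x 1] by simp

text \<open>The vector identity \<open>a = (I - T) 1\<close> in operator form: the next slot either
  refreshes or does not.\<close>

lemma sum_R_eq_one_minus_avoid: "x \<in> S \<Longrightarrow> (\<Sum>y\<in>R. P x y) = 1 - avoid (\<lambda>_. 1) x"
  using step_split[of "\<lambda>_. 1" x] step_const[of x 1] by simp

lemma avoid_one_le: "x \<in> S \<Longrightarrow> avoid (\<lambda>_. 1) x \<le> 1"
  using sum_R_eq_one_minus_avoid[of x] sum_nonneg[of R "P x"] P_nonneg R_subset by auto

text \<open>\<open>(avoid ^^ n) (\<lambda>_. 1) x\<close> is the probability that none of the n
  slots after \<open>x\<close> refreshes.\<close>

lemma survival_Suc_le: "x \<in> S \<Longrightarrow> (avoid ^^ Suc n) (\<lambda>_. 1) x \<le> (avoid ^^ n) (\<lambda>_. 1) x"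
  unfolding funpow_Suc_right o_def by (rule avoid_funpow_mono) (rule avoid_one_le)

lemma step_funpow_cong:
  "(\<And>y. y \<in> S \<Longrightarrow> f y = g y) \<Longrightarrow> x \<in> S \<Longrightarrow> (step ^^ n) f x = (step ^^ n) g x"
  by (induction n arbitrary: x) (auto intro: step_cong)

text \<open>\<open>(step ^^ n) (indicat_real {y}) x\<close> is the n-step probability from
  \<open>x\<close> to \<open>y\<close>; linearity lets these be summed over \<open>y\<close> or
  composed with one more transition.\<close>

lemma step_funpow_sum:
  "(step ^^ n) (\<lambda>x. \<Sum>i\<in>I. c i * F i x) = (\<lambda>x. \<Sum>i\<in>I. c i * (step ^^ n) (F i) x)"
proof (induction n)
  case (Suc n)
  have "step (\<lambda>x. \<Sum>i\<in>I. c i * G i x) = (\<lambda>x. \<Sum>i\<in>I. c i * step (G i) x)" for G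
    unfolding step_def
    by (rule ext, simp add: sum_distrib_left mult.left_commute, rule sum.swap)
  then show ?case by (simp add: Suc)
qed simp

lemma step_funpow_nonneg:
  assumes "\<And>y. y \<in> S \<Longrightarrow> 0 \<le> f y" "x \<in> S"
  shows "0 \<le> (step ^^ n) f x"
  using assms(2)
proof (induction n arbitrary: x)
  case (Suc n)
  then show ?case by (auto simp: step_def intro!: sum_nonneg mult_nonneg_nonneg P_nonneg)
qed (simp add: assms)

lemma step_funpow_const: "x \<in> S \<Longrightarrow> (step ^^ n) (\<lambda>_. c) x = c"
proof (induction n arbitrary: x)
  case (Suc n)
  have "step ((step ^^ n) (\<lambda>_. c)) x = step (\<lambda>_. c) x" by (rule step_cong) (rule Suc.IH)
  then show ?case using Suc.prems by (simp add: step_const)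
qed simp

text \<open>If no refresh were reachable from \<open>x\<close>, the Cesaro means of the laws started in \<open>x\<close>
  would converge to a stationary distribution without mass on \<open>R\<close>.\<close>

lemma refresh_reachable:
  assumes x: "x \<in> S"
  shows "\<exists>k\<ge>1. 0 < (step ^^ k) (indicat_real R) x"
proof (rule ccontr)
  assume no: "\<not> ?thesis"
  \<comment> \<open>Average of the n-step laws from \<open>x\<close>, over \<open>Suc N\<close>
    terms so that the total mass is 1 for every \<open>N\<close>.\<close>
  define f where "f N y = (\<Sum>k<Suc N. (step ^^ k) (indicat_real {y}) x) / real (Suc N)" for N y
  \<comment> \<open>By the contradiction hypothesis the only possible visit to \<open>R\<close> is
    at time 0, and its share of the average vanishes.\<close>
  have R0: "(step ^^ k) (indicat_real R) x = 0" if "k \<ge> 1" for k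
    using no that step_funpow_nonneg[of "indicat_real R" x k] x by (auto simp: not_less antisym)
  have ind: "(\<Sum>y\<in>A. F y * indicat_real {y} z) = (if z \<in> A then F z else 0)" if "A \<subseteq> S" for A F and z :: 's
    using finite_subset[OF that finite_S]
    by (subst sum.cong[OF refl, of _ _ "\<lambda>y. if z = y then F y else 0"]) (auto simp: indicator_def)
  have lim: "(\<lambda>N. f N y) \<longlonglongrightarrow> p y" if "y \<in> S" for y
  proof (rule almost_stationary_imp_tendsto[OF _ _ _ that])
    show "0 \<le> f N z" if "z \<in> S" for N z
      unfolding f_def using x by (intro divide_nonneg_nonneg sum_nonneg step_funpow_nonneg) auto
    show "(\<Sum>z\<in>S. f N z) = 1" for N
    proof -
      have "(\<Sum>z\<in>S. (step ^^ k) (indicat_real {z}) x) = 1" for k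
      proof -
        have "(\<Sum>z\<in>S. (step ^^ k) (indicat_real {z}) x) = (step ^^ k) (\<lambda>u. \<Sum>z\<in>S. 1 * indicat_real {z} u) x"
          unfolding step_funpow_sum by simp
        also have "\<dots> = (step ^^ k) (\<lambda>_. 1) x"
          by (rule step_funpow_cong[OF _ x], subst ind) auto
        finally show ?thesis using x by (simp add: step_funpow_const)
      qed
      then have "(\<Sum>z\<in>S. \<Sum>k<Suc N. (step ^^ k) (indicat_real {z}) x) = real (Suc N)"
        by (subst sum.swap) simp
      then show ?thesis unfolding f_def by (simp flip: sum_divide_distrib)
    qed
    show "(\<lambda>N. f N z - (\<Sum>u\<in>S. f N u * P u z)) \<longlonglongrightarrow> 0" if z: "z \<in> S" for z
    proof -
      \<comment> \<open>Chapman-Kolmogorov with the last transition split off; with it the defect of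
        stationarity telescopes to a boundary term over \<open>Suc N\<close>.\<close>
      have st: "(\<Sum>u\<in>S. (step ^^ k) (indicat_real {u}) x * P u z) = (step ^^ Suc k) (indicat_real {z}) x" for k
      proof -
        have "(\<Sum>u\<in>S. (step ^^ k) (indicat_real {u}) x * P u z)
            = (step ^^ k) (\<lambda>v. \<Sum>u\<in>S. P u z * indicat_real {u} v) x"
          unfolding step_funpow_sum by (simp add: mult.commute)
        also have "\<dots> = (step ^^ k) (step (indicat_real {z})) x"
        proof (rule step_funpow_cong[OF _ x])
          fix v assume "v \<in> S"
          then show "(\<Sum>u\<in>S. P u z * indicat_real {u} v) = step (indicat_real {z}) v"
            unfolding step_def using z finite_S by (subst ind) (auto simp: indicator_def if_distrib cong: if_cong)
        qed
        finally show ?thesis unfolding funpow_Suc_right o_def .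
      qed
      have eq: "f N z - (\<Sum>u\<in>S. f N u * P u z)
          = (indicat_real {z} x - (step ^^ Suc N) (indicat_real {z}) x) / real (Suc N)" for N
      proof -
        have "(\<Sum>u\<in>S. f N u * P u z) = (\<Sum>k<Suc N. (step ^^ Suc k) (indicat_real {z}) x) / real (Suc N)"
          unfolding f_def st[symmetric] by (subst sum.swap) (simp add: sum_distrib_right del: sum.lessThan_Suc flip: sum_divide_distrib)
        then have "f N z - (\<Sum>u\<in>S. f N u * P u z)
           = (\<Sum>k<Suc N. (step ^^ k) (indicat_real {z}) x - (step ^^ Suc k) (indicat_real {z}) x) / real (Suc N)"
          unfolding f_def by (simp only: sum_subtractf diff_divide_distrib)
        also have "\<dots> = (indicat_real {z} x - (step ^^ Suc N) (indicat_real {z}) x) / real (Suc N)"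
          by (subst sum_lessThan_telescope') simp
        finally show ?thesis .
      qed
      have le: "\<bar>(step ^^ k) (indicat_real {z}) x\<bar> \<le> 1" for k
      proof -
        have "(step ^^ k) (indicat_real {z}) x \<le> (step ^^ k) (\<lambda>_. 1) x"
          using x by (induction k arbitrary: x) (auto intro!: step_mono simp: indicator_def)
        then show ?thesis using x step_funpow_nonneg[of "indicat_real {z}" x k] by (simp add: step_funpow_const)
      qed
      have i1: "\<bar>indicat_real {z} x\<bar> \<le> 1" by (simp add: indicator_def)
      have "(\<lambda>N. 2 / real (Suc N)) \<longlonglongrightarrow> 0" by real_asymp
      then show ?thesis
      proof (rule Lim_null_comparison[rotated], intro always_eventually allI)
        fix N
        have "\<bar>indicat_real {z} x - (step ^^ Suc N) (indicat_real {z}) x\<bar> \<le> 2"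
          using le[of "Suc N"] i1 by linarith
        then show "norm (f N z - (\<Sum>u\<in>S. f N u * P u z)) \<le> 2 / real (Suc N)"
          unfolding eq by (simp add: divide_right_mono del: funpow.simps)
      qed
    qed
  qed
  have "(\<lambda>N. \<Sum>y\<in>R. f N y) \<longlonglongrightarrow> (\<Sum>y\<in>R. p y)"
    using R_subset by (intro tendsto_sum lim) auto
  moreover have "(\<Sum>y\<in>R. f N y) = indicat_real R x / real (Suc N)" for N
  proof -
    have "(\<Sum>y\<in>R. (step ^^ k) (indicat_real {y}) x) = (step ^^ k) (indicat_real R) x" for k
    proof -
      have "(\<Sum>y\<in>R. (step ^^ k) (indicat_real {y}) x) = (step ^^ k) (\<lambda>u. \<Sum>y\<in>R. 1 * indicat_real {y} u) x"
        unfolding step_funpow_sum by simp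
      also have "\<dots> = (step ^^ k) (indicat_real R) x"
        by (rule step_funpow_cong[OF _ x], subst ind[OF R_subset]) auto
      finally show ?thesis .
    qed
    then have "(\<Sum>y\<in>R. f N y) = (\<Sum>k<Suc N. (step ^^ k) (indicat_real R) x) / real (Suc N)"
      unfolding f_def by (simp only: flip: sum_divide_distrib, subst sum.swap) simp
    also have "(\<Sum>k<Suc N. (step ^^ k) (indicat_real R) x) = indicat_real R x"
      by (subst sum.lessThan_Suc_shift) (simp add: R0 del: funpow.simps(2))
    finally show ?thesis .
  qed
  moreover have "(\<lambda>N. indicat_real R x / real (Suc N)) \<longlonglongrightarrow> 0"
    using LIMSEQ_Suc[OF lim_const_over_n[of "indicat_real R x"]] by simp
  ultimately have "(\<Sum>y\<in>R. p y) = 0" using LIMSEQ_unique by simp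
  with p_R_pos show False by simp
qed

text \<open>No refresh in the next \<open>Suc k\<close> slots and a refresh in the last of them are
  disjoint events, so a positive hitting probability makes survival smaller than 1.\<close>

lemma survival_plus_hit_le:
  "x \<in> S \<Longrightarrow> (avoid ^^ Suc k) (\<lambda>_. 1) x + (step ^^ Suc k) (indicat_real R) x \<le> 1"
proof (induction k arbitrary: x)
  case 0
  have "step (indicat_real R) x = (\<Sum>y\<in>R. P x y)"
    unfolding step_split by (auto simp: avoid_def intro!: sum.neutral)
  then show ?case using 0 by (simp add: sum_R_eq_one_minus_avoid)
next
  case (Suc k)
  let ?f = "(avoid ^^ Suc k) (\<lambda>_. 1)" and ?g = "(step ^^ Suc k) (indicat_real R)"
  have g1: "?g y \<le> 1" if "y \<in> S" for y
    using Suc.IH[OF that] avoid_funpow_nonneg[of "\<lambda>_. 1" y "Suc k"] that by simp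
  have "avoid ?f x + step ?g x = avoid (\<lambda>y. ?f y + ?g y) x + (\<Sum>y\<in>R. P x y * ?g y)"
    unfolding step_split[of ?g] by (simp add: avoid_def sum.distrib distrib_left)
  also have "\<dots> \<le> avoid (\<lambda>_. 1) x + (\<Sum>y\<in>R. P x y * 1)"
    using Suc.prems Suc.IH g1 R_subset by (intro add_mono avoid_mono sum_mono mult_left_mono P_nonneg) auto
  also have "\<dots> = 1" using Suc.prems by (simp add: sum_R_eq_one_minus_avoid)
  finally show ?case by simp
qed

lemma survival_antimono:
  "m \<le> n \<Longrightarrow> x \<in> S \<Longrightarrow> (avoid ^^ n) (\<lambda>_. 1) x \<le> (avoid ^^ m) (\<lambda>_. 1) x"
proof (induction n rule: dec_induct)
  case (step n)
  then show ?case using survival_Suc_le[of x n] by (simp del: funpow.simps)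
qed simp

lemma survival_tendsto_0:
  assumes x: "x \<in> S"
  shows "(\<lambda>n. (avoid ^^ n) (\<lambda>_. 1) x) \<longlonglongrightarrow> 0"
proof -
  let ?q = "\<lambda>n. (avoid ^^ n) (\<lambda>_. 1 :: real)"
  have "\<exists>k. ?q k y < 1" if y: "y \<in> S" for y
  proof -
    obtain k where "k \<ge> 1" "0 < (step ^^ k) (indicat_real R) y" using refresh_reachable[OF y] by auto
    then show ?thesis using survival_plus_hit_le[OF y, of "k - 1"] by (intro exI[of _ k]) auto
  qed
  then obtain k where k: "\<And>y. y \<in> S \<Longrightarrow> ?q (k y) y < 1" by metis
  \<comment> \<open>A horizon common to all states; \<open>Suc\<close> makes it positive, so that
    the multiples of \<open>L\<close> form a genuine subsequence.\<close>
  define L where "L = Suc (Max (k ` S))"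
  have L: "?q L y < 1" if "y \<in> S" for y
  proof -
    have "k y \<le> L" unfolding L_def using that finite_S by (simp add: le_SucI)
    then show ?thesis using survival_antimono[of "k y" L y] k[OF that] that by auto
  qed
  define \<kappa> where "\<kappa> = Max (?q L ` S)"
  have \<kappa>: "\<kappa> < 1" "\<And>y. y \<in> S \<Longrightarrow> ?q L y \<le> \<kappa>"
    unfolding \<kappa>_def using finite_S S_nonempty L by auto
  have \<kappa>0: "0 \<le> \<kappa>" using \<kappa>(2)[OF x] avoid_funpow_nonneg[of "\<lambda>_. 1" x L] x by auto
  \<comment> \<open>Markov property over blocks of length \<open>L\<close>: surviving n blocks is at
    most the n-th power of the worst one-block survival.\<close>
  have geo: "?q (L * n) y \<le> \<kappa> ^ n" if "y \<in> S" for n y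
    using that
  proof (induction n arbitrary: y)
    case (Suc n)
    have "?q (L * Suc n) y = (avoid ^^ L) (?q (L * n)) y" by (simp add: funpow_add)
    also have "\<dots> \<le> (avoid ^^ L) (\<lambda>_. \<kappa> ^ n * 1) y"
      using Suc by (intro avoid_funpow_mono) auto
    also have "\<dots> = \<kappa> ^ n * ?q L y" by (simp only: avoid_funpow_cmult)
    also have "\<dots> \<le> \<kappa> ^ n * \<kappa>" using \<kappa>0 \<kappa>(2) Suc.prems by (intro mult_left_mono) auto
    finally show ?case by (simp add: mult.commute)
  qed simp
  have "(\<lambda>n. \<kappa> ^ n) \<longlonglongrightarrow> 0" using \<kappa> \<kappa>0 by (intro LIMSEQ_realpow_zero) auto
  then have 1: "(\<lambda>n. ?q (L * n) x) \<longlonglongrightarrow> 0"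
    by (rule Lim_null_comparison[rotated])
       (use geo[OF x] avoid_funpow_nonneg[of "\<lambda>_. 1" x] x in \<open>auto intro!: always_eventually\<close>)
  have "decseq (\<lambda>n. ?q n x)" using x by (intro decseq_SucI survival_Suc_le)
  moreover have "\<And>n. 0 \<le> ?q n x" using x by (intro avoid_funpow_nonneg) auto
  ultimately obtain t where t: "(\<lambda>n. ?q n x) \<longlonglongrightarrow> t"
    using decseq_convergent by metis
  have "strict_mono (\<lambda>n. L * n)" by (auto simp: strict_mono_def L_def simp del: mult_Suc)
  from LIMSEQ_subseq_LIMSEQ[OF t this] have "(\<lambda>n. ?q (L * n) x) \<longlonglongrightarrow> t" by (simp add: o_def)
  then have "t = 0" using 1 by (rule LIMSEQ_unique)
  with t show ?thesis by simp
qed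

text \<open>A minimum principle: \<open>u\<close> lies above its iterates under
  \<open>avoid\<close>, and these lie above \<open>- B\<close> times the survival probability, which
  tends to 0.\<close>

lemma avoid_superharmonic_nonneg:
  assumes sup: "\<And>x. x \<in> S \<Longrightarrow> avoid u x \<le> u x" and x: "x \<in> S"
  shows "0 \<le> u x"
proof -
  define B where "B = (\<Sum>y\<in>S. \<bar>u y\<bar>)"
  have B: "- B * 1 \<le> u y" if "y \<in> S" for y
    using member_le_sum[of y S "\<lambda>y. \<bar>u y\<bar>"] that finite_S unfolding B_def by auto
  have iter: "(avoid ^^ n) u y \<le> u y" if "y \<in> S" for n y
    using that
  proof (induction n arbitrary: y)
    case (Suc n)
    have "avoid ((avoid ^^ n) u) y \<le> avoid u y" using Suc by (intro avoid_mono) auto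
    then show ?case using sup[OF Suc.prems] by simp
  qed simp
  have "- B * (avoid ^^ n) (\<lambda>_. 1) x \<le> u x" for n
  proof -
    have "- B * (avoid ^^ n) (\<lambda>_. 1) x = (avoid ^^ n) (\<lambda>_. - B * 1) x"
      by (simp only: avoid_funpow_cmult)
    also have "\<dots> \<le> (avoid ^^ n) u x" using x B by (intro avoid_funpow_mono) auto
    also have "\<dots> \<le> u x" by (rule iter[OF x])
    finally show ?thesis .
  qed
  moreover have "(\<lambda>n. - B * (avoid ^^ n) (\<lambda>_. 1) x) \<longlonglongrightarrow> - B * 0"
    by (intro tendsto_intros survival_tendsto_0 x)
  ultimately show ?thesis by (intro LIMSEQ_le_const2[of _ "- B * 0", simplified]) auto
qed

text \<open>Injectivity of \<open>I - T\<close>, by the minimum principle for \<open>u\<close> and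
  for \<open>-u\<close>.\<close>

lemma avoid_harmonic_eq_0:
  assumes "\<And>x. x \<in> S \<Longrightarrow> u x = avoid u x" "x \<in> S"
  shows "u x = 0"
proof -
  have "0 \<le> u x" using assms by (intro avoid_superharmonic_nonneg[of u]) auto
  moreover have "avoid (\<lambda>x. -1 * u x) y \<le> -1 * u y" if "y \<in> S" for y
    using assms(1)[OF that] by (simp only: avoid_cmult)
  then have "0 \<le> -1 * u x" using assms by (intro avoid_superharmonic_nonneg[of "\<lambda>x. -1 * u x"])
  ultimately show ?thesis by simp
qed

text \<open>Stationarity turns the \<open>p\<close>-sum of \<open>avoid u\<close> into the
  \<open>p\<close>-sum of \<open>u\<close> off \<open>R\<close>, so subtracting leaves the part on
  \<open>R\<close>. With \<open>f = 1\<close> this is Kac's formula; with \<open>f = g\<close> it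
  converts the squared inverse into the stationary mean of \<open>g\<close>.\<close>

lemma sum_refresh_eq_sum_stationary:
  assumes "\<And>x. x \<in> S \<Longrightarrow> u x = f x + avoid u x"
  shows "(\<Sum>x\<in>R. p x * u x) = (\<Sum>x\<in>S. p x * f x)"
proof -
  have "(\<Sum>x\<in>S. p x * avoid u x) = (\<Sum>y\<in>S - R. \<Sum>x\<in>S. p x * P x y * u y)"
    unfolding avoid_def by (subst sum.swap) (simp add: sum_distrib_left mult.assoc)
  also have "\<dots> = (\<Sum>y\<in>S - R. p y * u y)"
    by (intro sum.cong refl) (simp add: p_stationary[symmetric] flip: sum_distrib_right)
  finally have "(\<Sum>x\<in>S. p x * avoid u x) = (\<Sum>y\<in>S - R. p y * u y)" .
  moreover have "(\<Sum>x\<in>S. p x * u x) = (\<Sum>x\<in>S. p x * f x) + (\<Sum>x\<in>S. p x * avoid u x)"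
    using assms by (simp add: distrib_left flip: sum.distrib)
  moreover have "(\<Sum>x\<in>S. p x * u x) = (\<Sum>x\<in>S - R. p x * u x) + (\<Sum>x\<in>R. p x * u x)"
    using R_subset finite_S by (rule sum.subset_diff)
  ultimately show ?thesis by simp
qed

lemma step_if:
  "step (\<lambda>y. if y \<in> R then c y else f y) x = avoid f x + (\<Sum>y\<in>R. P x y * c y)"
  unfolding step_split avoid_def by (intro arg_cong2[where f="(+)"] sum.cong) auto

lemma hitting_time_ge_1:
  assumes g: "\<And>x. x \<in> S \<Longrightarrow> g x = 1 + avoid g x" and x: "x \<in> S"
  shows "1 \<le> g x"
proof -
  have "0 \<le> g y" if "y \<in> S" for y
    using g that by (intro avoid_superharmonic_nonneg[of g]) auto
  then show ?thesis using g[OF x] avoid_nonneg[of g x] x by simp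
qed

end

section \<open>Strong laws along a path of the chain\<close>

abbreviation cesaro :: "(nat \<Rightarrow> real) \<Rightarrow> nat \<Rightarrow> real" where
  "cesaro f N \<equiv> (\<Sum>s<N. f s) / real N"

text \<open>Trading \<open>f (Suc s)\<close> for \<open>f s\<close> costs only a boundary term
  divided by \<open>N\<close>.\<close>

lemma cesaro_shift_diff:
  "cesaro (\<lambda>s. f (Suc s) - g s) N = cesaro (\<lambda>s. f s - g s) N + (f N - f 0) / real N"
proof -
  have "(\<Sum>s<N. f (Suc s) - g s) = (\<Sum>s<N. f s - g s) + (f N - f 0)"
    by (induction N) auto
  then show ?thesis by (simp add: add_divide_distrib)
qed

lemma cesaro_sum: "cesaro (\<lambda>s. \<Sum>y\<in>A. g y s) N = (\<Sum>y\<in>A. cesaro (g y) N)"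
  by (subst sum.swap) (simp add: sum_divide_distrib)

lemma cesaro_cmult: "cesaro (\<lambda>s. c * f s) N = c * cesaro f N"
  by (simp add: sum_distrib_left)

text \<open>\<open>X_markov\<close> prescribes the probability of every finite path, so expectations
  of functions of a history become finite weighted sums.\<close>

locale refreshing_chain_path = refreshing_chain S P R p + prob_space M
  for S :: "'s set" and P R p and M :: "'w measure" +
  fixes \<mu>0 :: "'s \<Rightarrow> real" and X :: "nat \<Rightarrow> 'w \<Rightarrow> 's"
  assumes X_meas: "\<And>s. X s \<in> measurable M (count_space UNIV)"
    and X_range: "\<And>s w. w \<in> space M \<Longrightarrow> X s w \<in> S"
    and X_markov: "\<And>m xs. length xs = Suc m \<Longrightarrow> set xs \<subseteq> S \<Longrightarrow>
        measure M {w \<in> space M. \<forall>k\<le>m. X k w = xs ! k}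
          = \<mu>0 (xs ! 0) * (\<Prod>k<m. P (xs ! k) (xs ! Suc k))"
begin

text \<open>Histories are kept with the most recent state first.\<close>

primrec hist :: "nat \<Rightarrow> 'w \<Rightarrow> 's list" where
  "hist 0 w = [X 0 w]"
| "hist (Suc m) w = X (Suc m) w # hist m w"

text \<open>Probability of a history. With the most recent state first, one more slot is a single
  Cons and contributes a single factor.\<close>

fun weight :: "'s list \<Rightarrow> real" where
  "weight [] = 1"
| "weight [x] = \<mu>0 x"
| "weight (y # x # xs) = weight (x # xs) * P x y"

definition histories :: "nat \<Rightarrow> 's list set" where
  "histories m = {h. set h \<subseteq> S \<and> length h = Suc m}"

lemma finite_histories: "finite (histories m)"
  unfolding histories_def using finite_S by (rule finite_lists_length_eq)

lemma length_hist [simp]: "length (hist m w) = Suc m"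
  by (induction m) auto

lemma hd_hist [simp]: "hd (hist m w) = X m w"
  by (cases m) auto

lemma hist_in_histories: "w \<in> space M \<Longrightarrow> hist m w \<in> histories m"
  unfolding histories_def by (induction m) (auto simp: X_range)

text \<open>Adaptedness: what is known in slot \<open>s\<close> is a function of every later
  history.\<close>

lemma drop_hist: "hist s w = drop k (hist (k + s) w)"
  by (induction k) auto

lemma hist_eq_iff: "length h = Suc m \<Longrightarrow> hist m w = h \<longleftrightarrow> (\<forall>k\<le>m. X k w = rev h ! k)"
proof (induction m arbitrary: h)
  case 0
  then show ?case by (cases h) auto
next
  case (Suc m)
  then obtain y h' where h: "h = y # h'" "length h' = Suc m" by (cases h) auto
  have "(\<forall>k\<le>Suc m. X k w = rev h ! k) \<longleftrightarrow> (\<forall>k\<le>m. X k w = rev h' ! k) \<and> X (Suc m) w = y"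
    using h(2) unfolding h(1) by (auto simp: le_Suc_eq nth_append)
  then show ?case using Suc.IH[OF h(2)] h(1) by auto
qed

lemma weight_rev:
  "length h = Suc m \<Longrightarrow> weight h = \<mu>0 (rev h ! 0) * (\<Prod>k<m. P (rev h ! k) (rev h ! Suc k))"
proof (induction m arbitrary: h)
  case 0
  then obtain x where "h = [x]" by (cases h) auto
  then show ?case by simp
next
  case (Suc m)
  then obtain y h1 where h1: "h = y # h1" "length h1 = Suc m" by (cases h) auto
  then obtain x h' where h: "h = y # x # h'" "length (x # h') = Suc m" by (cases h1) auto
  define r r' where "r = rev h" and "r' = rev (x # h')"
  have r: "r ! k = r' ! k" if "k \<le> m" for k
    using that h(2) unfolding h(1) r_def r'_def by (simp add: nth_append)
  have "r ! Suc m = y" "r ! m = x"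
    using h(2) unfolding h(1) r_def by (simp_all add: nth_append)
  moreover have "(\<Prod>k<m. P (r' ! k) (r' ! Suc k)) = (\<Prod>k<m. P (r ! k) (r ! Suc k))"
    by (rule prod.cong) (simp_all add: r)
  moreover have "weight h = (\<mu>0 (r' ! 0) * (\<Prod>k<m. P (r' ! k) (r' ! Suc k))) * P x y"
    unfolding h(1) weight.simps Suc.IH[OF h(2)] r'_def ..
  ultimately show ?case unfolding r_def[symmetric] by (simp add: r)
qed

lemma hist_sets: "{w \<in> space M. hist m w = h} \<in> sets M"
proof (cases "length h = Suc m")
  case True
  have "X k -` {c} \<inter> space M \<in> sets M" for k c by (rule measurable_sets[OF X_meas]) simp
  then have "(\<Inter>k\<in>{..m}. X k -` {rev h ! k} \<inter> space M) \<in> sets M" by (intro sets.finite_INT) auto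
  also have "(\<Inter>k\<in>{..m}. X k -` {rev h ! k} \<inter> space M) = {w \<in> space M. \<forall>k\<le>m. X k w = rev h ! k}" by auto
  finally show ?thesis unfolding hist_eq_iff[OF True] .
next
  case False
  then have "hist m w \<noteq> h" for w by (metis length_hist)
  then have "{w \<in> space M. hist m w = h} = {}" by simp
  then show ?thesis by (simp only: sets.empty_sets)
qed

lemma prob_hist: "h \<in> histories m \<Longrightarrow> prob {w \<in> space M. hist m w = h} = weight h"
  using X_markov[of "rev h" m] unfolding histories_def
  by (simp add: hist_eq_iff weight_rev[of h m])

text \<open>Only finitely many histories of a given length occur, so any \<open>F\<close> of a
  history is a simple function; integrability and the expectation formula follow from this
  expansion.\<close>

lemma fun_hist_eq:
  assumes "w \<in> space M"
  shows "F (hist m w) = (\<Sum>h\<in>histories m. F h * indicat_real {w \<in> space M. hist m w = h} w)"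
proof -
  have "(\<Sum>h\<in>histories m. F h * indicat_real {w \<in> space M. hist m w = h} w)
      = (\<Sum>h\<in>histories m. if h = hist m w then F h else 0)"
    using assms by (intro sum.cong) auto
  also have "\<dots> = F (hist m w)"
    using hist_in_histories[OF assms, of m] finite_histories[of m] by simp
  finally show ?thesis ..
qed

lemma integrable_hist [simp]: "integrable M (\<lambda>w. F (hist m w) :: real)"
  by (subst Bochner_Integration.integrable_cong[OF refl fun_hist_eq], assumption)
     (intro Bochner_Integration.integrable_sum integrable_mult_right integrable_real_indicator hist_sets, simp add: less_top[symmetric])

lemma expectation_hist: "expectation (\<lambda>w. F (hist m w)) = (\<Sum>h\<in>histories m. F h * weight h)"
proof -
  have "expectation (\<lambda>w. F (hist m w))
    = expectation (\<lambda>w. \<Sum>h\<in>histories m. F h * indicat_real {w \<in> space M. hist m w = h} w)"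
    by (rule Bochner_Integration.integral_cong[OF refl fun_hist_eq])
  also have "\<dots> = (\<Sum>h\<in>histories m. expectation (\<lambda>w. F h * indicat_real {w \<in> space M. hist m w = h} w))"
    by (rule Bochner_Integration.integral_sum)
       (intro integrable_mult_right integrable_real_indicator hist_sets, simp add: less_top[symmetric])
  also have "\<dots> = (\<Sum>h\<in>histories m. F h * weight h)"
  proof (intro sum.cong refl)
    fix h assume h: "h \<in> histories m"
    have "{w \<in> space M. hist m w = h} \<inter> space M = {w \<in> space M. hist m w = h}" by auto
    then show "expectation (\<lambda>w. F h * indicat_real {w \<in> space M. hist m w = h} w) = F h * weight h"
      using prob_hist[OF h] by simp
  qed
  finally show ?thesis .
qed

lemma sum_histories_Suc:
  "(\<Sum>h\<in>histories (Suc m). F h) = (\<Sum>h\<in>histories m. \<Sum>y\<in>S. F (y # h))"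
proof -
  have "histories (Suc m) = (\<lambda>(h, y). y # h) ` (histories m \<times> S)"
    unfolding histories_def by (auto simp: length_Suc_conv image_iff)
  moreover have "inj_on (\<lambda>(h, y). y # h) (histories m \<times> S)" by (auto simp: inj_on_def)
  ultimately show ?thesis by (simp add: sum.reindex sum.cartesian_product split_def)
qed

text \<open>Conditional expectation of \<open>\<phi>\<close> one slot later, given the history
  \<open>h\<close>; by the Markov property the transition law depends on \<open>hd h\<close>
  alone.\<close>

definition predict :: "('s list \<Rightarrow> real) \<Rightarrow> 's list \<Rightarrow> real" where
  "predict \<phi> h = (\<Sum>y\<in>S. P (hd h) y * \<phi> (y # h))"

text \<open>Tower property, tested against an arbitrary function \<open>\<psi>\<close> of the past;
  it comes from splitting off the newest factor of \<open>weight\<close>.\<close>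

lemma expectation_predict:
  "expectation (\<lambda>w. \<psi> (hist m w) * \<phi> (hist (Suc m) w)) = expectation (\<lambda>w. \<psi> (hist m w) * predict \<phi> (hist m w))"
proof -
  have "expectation (\<lambda>w. \<psi> (hist m w) * \<phi> (hist (Suc m) w))
      = (\<Sum>h\<in>histories m. \<Sum>y\<in>S. \<psi> h * \<phi> (y # h) * weight (y # h))"
    using expectation_hist[of "\<lambda>h. \<psi> (tl h) * \<phi> h" "Suc m"] unfolding sum_histories_Suc by simp
  also have "\<dots> = (\<Sum>h\<in>histories m. \<psi> h * predict \<phi> h * weight h)"
  proof (intro sum.cong refl)
    fix h assume "h \<in> histories m"
    then obtain x h' where h: "h = x # h'" by (cases h) (auto simp: histories_def)
    show "(\<Sum>y\<in>S. \<psi> h * \<phi> (y # h) * weight (y # h)) = \<psi> h * predict \<phi> h * weight h"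
      unfolding h predict_def by (simp add: sum_distrib_left sum_distrib_right mult_ac)
  qed
  also have "\<dots> = expectation (\<lambda>w. \<psi> (hist m w) * predict \<phi> (hist m w))"
    using expectation_hist[of "\<lambda>h. \<psi> h * predict \<phi> h" m] by simp
  finally show ?thesis .
qed

section \<open>Averages of prediction errors\<close>

lemma expectation_mono_hist:
  fixes F G :: "'s list \<Rightarrow> real"
  assumes "\<And>h. h \<in> histories m \<Longrightarrow> F h \<le> G h"
  shows "expectation (\<lambda>w. F (hist m w)) \<le> expectation (\<lambda>w. G (hist m w))"
  by (rule Bochner_Integration.integral_mono) (auto intro: assms hist_in_histories)

text \<open>Prediction errors are martingale differences: the earlier of two errors is a function of
  the past of the later one, so the tower property makes them orthogonal.\<close>

lemma prediction_error_strong_law: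
  assumes bnd: "\<And>m. expectation (\<lambda>w. (\<phi> (hist m w))\<^sup>2) \<le> C"
  shows "AE w in M. (\<lambda>N. cesaro (\<lambda>s. \<phi> (hist (Suc s) w) - predict \<phi> (hist s w)) N) \<longlonglongrightarrow> 0"
proof (rule orthogonal_strong_law)
  \<comment> \<open>The error as a function of the newer history alone, the older one being its
    tail.\<close>
  let ?D = "\<lambda>h. \<phi> h - predict \<phi> (tl h)"
  let ?d = "\<lambda>s w. \<phi> (hist (Suc s) w) - predict \<phi> (hist s w)"
  have d: "?d s w = ?D (hist (Suc s) w)" for s w by simp
  show "?d s \<in> borel_measurable M" for s
    unfolding d by (rule borel_measurable_integrable) (rule integrable_hist)
  have dpast: "?d s w = ?D (drop (t - Suc s) (hist t w))" if "s < t" for s t w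
  proof -
    have e: "drop (t - Suc s) (hist t w) = hist (Suc s) w"
      using drop_hist[of "Suc s" w "t - Suc s"] that by (simp del: hist.simps)
    show ?thesis unfolding e by simp
  qed
  have orth_lt: "expectation (\<lambda>w. ?d s w * ?d t w) = 0" if st: "s < t" for s t
  proof -
    let ?\<psi> = "\<lambda>h. ?D (drop (t - Suc s) h)"
    have "expectation (\<lambda>w. ?d s w * ?d t w)
        = expectation (\<lambda>w. ?\<psi> (hist t w) * \<phi> (hist (Suc t) w) - ?\<psi> (hist t w) * predict \<phi> (hist t w))"
      unfolding dpast[OF st] by (simp add: right_diff_distrib)
    also have "\<dots> = expectation (\<lambda>w. ?\<psi> (hist t w) * \<phi> (hist (Suc t) w))
          - expectation (\<lambda>w. ?\<psi> (hist t w) * predict \<phi> (hist t w))"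
    proof (rule Bochner_Integration.integral_diff)
      show "integrable M (\<lambda>w. ?\<psi> (hist t w) * \<phi> (hist (Suc t) w))"
        using integrable_hist[of "\<lambda>h. ?\<psi> (tl h) * \<phi> h" "Suc t"] by simp
      show "integrable M (\<lambda>w. ?\<psi> (hist t w) * predict \<phi> (hist t w))" by (rule integrable_hist)
    qed
    also have "\<dots> = 0" using expectation_predict[of ?\<psi> t \<phi>] by simp
    finally show ?thesis .
  qed
  show "expectation (\<lambda>w. ?d s w * ?d t w) = 0" if "s \<noteq> t" for s t
    using orth_lt[of s t] orth_lt[of t s] that by (cases "s < t") (auto simp: mult.commute)
  show "integrable M (\<lambda>w. ?d s w * ?d t w)" for s t
  proof -
    have e: "drop t (hist (Suc (s + t)) w) = hist (Suc s) w" "drop s (hist (Suc (s + t)) w) = hist (Suc t) w" for w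
      using drop_hist[of "Suc s" w t] drop_hist[of "Suc t" w s] by (simp_all add: add.commute del: hist.simps)
    have "integrable M (\<lambda>w. (\<lambda>h. ?D (drop t h) * ?D (drop s h)) (hist (Suc (s + t)) w))"
      by (rule integrable_hist)
    then show ?thesis unfolding e d[symmetric] .
  qed
  \<comment> \<open>Pythagoras: subtracting the prediction can only lower the second moment, so the
    bound \<open>C\<close> carries over.\<close>
  show "expectation (\<lambda>w. (?d s w)\<^sup>2) \<le> C" for s
  proof -
    let ?\<psi> = "predict \<phi>"
    have e: "expectation (\<lambda>w. ?\<psi> (hist s w) * \<phi> (hist (Suc s) w)) = expectation (\<lambda>w. (?\<psi> (hist s w))\<^sup>2)"
      unfolding expectation_predict by (simp add: power2_eq_square)
    have i1: "integrable M (\<lambda>w. ?\<psi> (hist s w) * \<phi> (hist (Suc s) w))"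
      using integrable_hist[of "\<lambda>h. ?\<psi> (tl h) * \<phi> h" "Suc s"] by simp
    have "expectation (\<lambda>w. (?d s w)\<^sup>2)
       = expectation (\<lambda>w. (\<phi> (hist (Suc s) w))\<^sup>2 + (?\<psi> (hist s w))\<^sup>2 - 2 * (?\<psi> (hist s w) * \<phi> (hist (Suc s) w)))"
      by (simp add: power2_diff mult_ac)
    also have "\<dots> = expectation (\<lambda>w. (\<phi> (hist (Suc s) w))\<^sup>2) + expectation (\<lambda>w. (?\<psi> (hist s w))\<^sup>2)
        - 2 * expectation (\<lambda>w. ?\<psi> (hist s w) * \<phi> (hist (Suc s) w))"
      using i1 integrable_hist[of "\<lambda>h. (\<phi> h)\<^sup>2" "Suc s"] integrable_hist[of "\<lambda>h. (?\<psi> h)\<^sup>2" s]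
      by (simp del: integrable_hist hist.simps)
    also have "\<dots> \<le> expectation (\<lambda>w. (\<phi> (hist (Suc s) w))\<^sup>2)"
      unfolding e using integral_nonneg_AE[where f="\<lambda>w. (?\<psi> (hist s w))\<^sup>2" and M=M] by simp
    finally show ?thesis using bnd[of "Suc s"] by linarith
  qed
qed

text \<open>Bounded second moments make the squares of \<open>\<phi> (hist N w) / N\<close> summable
  in mean; this disposes of the boundary term of the shift.\<close>

lemma hist_over_time_tendsto_0:
  assumes bnd: "\<And>m. expectation (\<lambda>w. (\<phi> (hist m w))\<^sup>2) \<le> C"
  shows "AE w in M. (\<lambda>N. \<phi> (hist N w) / real N) \<longlonglongrightarrow> 0"
proof -
  have "AE w in M. (\<lambda>N. (\<phi> (hist N w))\<^sup>2 / (real N)\<^sup>2) \<longlonglongrightarrow> 0"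
  proof (rule AE_tendsto_0_if_summable_integral)
    show "integrable M (\<lambda>w. (\<phi> (hist k w))\<^sup>2 / (real k)\<^sup>2)" for k
      by (rule integrable_hist)
    show "summable (\<lambda>k. expectation (\<lambda>w. (\<phi> (hist k w))\<^sup>2 / (real k)\<^sup>2))"
    proof (rule summable_comparison_test)
      have "norm (expectation (\<lambda>w. (\<phi> (hist n w))\<^sup>2 / (real n)\<^sup>2)) \<le> C * (1 / (real n)\<^sup>2)" for n
        using divide_right_mono[OF bnd[of n], of "(real n)\<^sup>2"] by (simp add: integral_nonneg_AE)
      then show "\<exists>N. \<forall>n\<ge>N. norm (expectation (\<lambda>w. (\<phi> (hist n w))\<^sup>2 / (real n)\<^sup>2)) \<le> C * (1 / (real n)\<^sup>2)"
        by blast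
      show "summable (\<lambda>n. C * (1 / (real n)\<^sup>2))"
        using inverse_power_summable[of 2, where ?'a=real]
        by (intro summable_mult) (simp add: field_simps)
    qed
  qed simp
  then show ?thesis
  proof eventually_elim
    case (elim w)
    have "(\<lambda>N. sqrt ((\<phi> (hist N w))\<^sup>2 / (real N)\<^sup>2)) \<longlonglongrightarrow> sqrt 0"
      by (intro tendsto_intros elim)
    then have "(\<lambda>N. \<bar>\<phi> (hist N w) / real N\<bar>) \<longlonglongrightarrow> 0" by (simp add: real_sqrt_divide)
    then show ?case by (rule tendsto_rabs_zero_cancel)
  qed
qed

text \<open>With both terms at the same slot, writing a function as
  \<open>\<phi> - predict \<phi>\<close> plus a remainder reduces its time average to that of the
  remainder.\<close>

lemma stationary_prediction_strong_law:
  assumes bnd: "\<And>m. expectation (\<lambda>w. (\<phi> (hist m w))\<^sup>2) \<le> C"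
  shows "AE w in M. cesaro (\<lambda>s. \<phi> (hist s w) - predict \<phi> (hist s w)) \<longlonglongrightarrow> 0"
  using prediction_error_strong_law[OF bnd] hist_over_time_tendsto_0[OF bnd]
proof eventually_elim
  case (elim w)
  have "(\<lambda>N. cesaro (\<lambda>s. \<phi> (hist (Suc s) w) - predict \<phi> (hist s w)) N
      - (\<phi> (hist N w) / real N - \<phi> (hist 0 w) / real N)) \<longlonglongrightarrow> 0 - (0 - 0)"
    by (intro tendsto_diff elim lim_const_over_n)
  then show ?case
    unfolding cesaro_shift_diff[of "\<lambda>s. \<phi> (hist s w)"] by (simp add: diff_divide_distrib del: hist.simps)
qed

lemma bounded_second_moment:
  fixes \<phi> :: "'s list \<Rightarrow> real"
  assumes "\<And>m h. h \<in> histories m \<Longrightarrow> \<bar>\<phi> h\<bar> \<le> B"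
  shows "expectation (\<lambda>w. (\<phi> (hist m w))\<^sup>2) \<le> B\<^sup>2"
proof -
  have "(\<phi> h)\<^sup>2 \<le> B\<^sup>2" if "h \<in> histories m" for h
    using power_mono[OF assms[OF that] abs_ge_zero, of 2] by simp
  then have "expectation (\<lambda>w. (\<phi> (hist m w))\<^sup>2) \<le> expectation (\<lambda>w. B\<^sup>2)"
    by (rule expectation_mono_hist)
  then show ?thesis by (simp add: prob_space)
qed

lemma state_frequency:
  assumes y: "y \<in> S"
  shows "AE w in M. cesaro (\<lambda>s. indicat_real {y} (X s w)) \<longlonglongrightarrow> p y"
proof -
  have "AE w in M. cesaro (\<lambda>s. indicat_real {z} (hd (hist s w)) - predict (\<lambda>h. indicat_real {z} (hd h)) (hist s w)) \<longlonglongrightarrow> 0" for z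
    by (rule stationary_prediction_strong_law, rule bounded_second_moment[of _ 1]) (auto simp: indicator_def)
  then have "AE w in M. \<forall>z\<in>S. cesaro (\<lambda>s. indicat_real {z} (hd (hist s w)) - predict (\<lambda>h. indicat_real {z} (hd h)) (hist s w)) \<longlonglongrightarrow> 0"
    using finite_S by (simp add: AE_finite_all)
  then show ?thesis using AE_space
  proof eventually_elim
    case (elim w)
    have Xw: "X s w \<in> S" for s using elim(2) by (rule X_range)
    \<comment> \<open>\<open>Suc N\<close> avoids the empty average, whose total mass would be 0
      instead of 1.\<close>
    define f where "f N x = cesaro (\<lambda>s. indicat_real {x} (X s w)) (Suc N)" for N x
    have "(\<lambda>N. f N y) \<longlonglongrightarrow> p y"
    proof (rule almost_stationary_imp_tendsto[OF _ _ _ y])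
      show "0 \<le> f N x" for N x unfolding f_def by (intro divide_nonneg_nonneg sum_nonneg) auto
      have s1: "(\<Sum>x\<in>S. F x * indicat_real {x} (X s w)) = F (X s w)" for F s
        using Xw[of s] finite_S by (subst sum.cong[OF refl, of _ _ "\<lambda>x. if X s w = x then F x else 0"]) (auto simp: indicator_def)
      show "(\<Sum>x\<in>S. f N x) = 1" for N
      proof -
        have "(\<Sum>x\<in>S. \<Sum>s<Suc N. 1 * indicat_real {x} (X s w)) = (\<Sum>s<Suc N. 1)"
          by (subst sum.swap) (simp only: s1)
        then show ?thesis unfolding f_def by (simp add: field_simps flip: sum_divide_distrib)
      qed
      show "(\<lambda>N. f N z - (\<Sum>x\<in>S. f N x * P x z)) \<longlonglongrightarrow> 0" if z: "z \<in> S" for z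
      proof -
        have pr: "predict (\<lambda>h. indicat_real {z} (hd h)) (hist s w) = (\<Sum>x\<in>S. P x z * indicat_real {x} (X s w))" for s
        proof -
          have "predict (\<lambda>h. indicat_real {z} (hd h)) (hist s w) = (\<Sum>v\<in>S. if v = z then P (X s w) v else 0)"
            unfolding predict_def by (intro sum.cong) (auto simp: indicator_def)
          then show ?thesis unfolding s1 using z finite_S by simp
        qed
        have "f N z - (\<Sum>x\<in>S. f N x * P x z)
           = cesaro (\<lambda>s. indicat_real {z} (hd (hist s w)) - predict (\<lambda>h. indicat_real {z} (hd h)) (hist s w)) (Suc N)" for N
        proof -
          have "(\<Sum>x\<in>S. f N x * P x z) = cesaro (\<lambda>s. \<Sum>x\<in>S. P x z * indicat_real {x} (X s w)) (Suc N)"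
            unfolding f_def cesaro_sum cesaro_cmult by (simp only: mult.commute)
          then show ?thesis
            by (simp only: pr f_def sum_subtractf diff_divide_distrib hd_hist)
        qed
        then show ?thesis using LIMSEQ_Suc[OF bspec[OF elim(1) z]] by simp
      qed
    qed
    from this[unfolded f_def] show ?case by (rule LIMSEQ_imp_Suc)
  qed
qed

lemma function_frequency:
  "AE w in M. cesaro (\<lambda>s. f (X s w)) \<longlonglongrightarrow> (\<Sum>x\<in>S. p x * f x)"
proof -
  have "AE w in M. \<forall>y\<in>S. cesaro (\<lambda>s. indicat_real {y} (X s w)) \<longlonglongrightarrow> p y"
    using finite_S state_frequency by (simp add: AE_finite_all)
  then show ?thesis using AE_space
  proof eventually_elim
    case (elim w)
    have eq: "f (X s w) = (\<Sum>y\<in>S. f y * indicat_real {y} (X s w))" for s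
      using X_range[OF elim(2), of s] finite_S
      by (subst sum.cong[OF refl, of _ _ "\<lambda>y. if X s w = y then f y else 0"]) (auto simp: indicator_def)
    have "cesaro (\<lambda>s. f (X s w)) = (\<lambda>N. \<Sum>y\<in>S. f y * cesaro (\<lambda>s. indicat_real {y} (X s w)) N)"
      unfolding eq cesaro_sum cesaro_cmult ..
    moreover have "(\<lambda>N. \<Sum>y\<in>S. f y * cesaro (\<lambda>s. indicat_real {y} (X s w)) N) \<longlonglongrightarrow> (\<Sum>y\<in>S. f y * p y)"
      by (intro tendsto_intros) (use elim(1) in blast)
    ultimately show ?case by (simp only: mult.commute)
  qed
qed

section \<open>The age process\<close>

text \<open>The age in the last slot of a history, counted from \<open>2\<close> at the start as if a refresh had
  preceded it; this convention does not affect long-run fractions.\<close>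

fun age :: "'s list \<Rightarrow> nat" where
  "age [] = 2"
| "age [x] = 2"
| "age (y # x # h) = (if x \<in> R then 2 else Suc (age (x # h)))"

lemma age_Cons: "h \<noteq> [] \<Longrightarrow> age (y # h) = (if hd h \<in> R then 2 else Suc (age h))"
  by (cases h) auto

lemma hist_nonempty [simp]: "hist m w \<noteq> []"
  by (cases m) auto

lemma age_hist_Suc: "age (hist (Suc m) w) = (if X m w \<in> R then 2 else Suc (age (hist m w)))"
  by (simp add: age_Cons)

lemma age_ge_2: "2 \<le> age h"
  by (induction h rule: age.induct) auto

lemma history_hd: "h \<in> histories m \<Longrightarrow> h \<noteq> [] \<and> hd h \<in> S"
  by (cases h) (auto simp: histories_def)

text \<open>The next age is fixed by the present history, so only the factor \<open>f\<close> is
  random and \<open>step\<close> averages it.\<close>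

lemma predict_age:
  assumes "h \<noteq> []"
  shows "predict (\<lambda>h. F (age h) * f (hd h)) h = F (if hd h \<in> R then 2 else Suc (age h)) * step f (hd h)"
  unfolding predict_def step_def using assms
  by (simp add: age_Cons sum_distrib_left mult.left_commute del: age.simps)

text \<open>A Foster-Lyapunov bound: \<open>g\<close> loses 1 per slot in expectation, which
  outweighs the growth of the squared age once the age is large.\<close>

lemma age_second_moment_bounded:
  assumes g: "\<And>x. x \<in> S \<Longrightarrow> g x = 1 + avoid g x"
  obtains B where "\<And>m. expectation (\<lambda>w. (real (age (hist m w)))\<^sup>2) \<le> B"
proof -
  define G where "G = (\<Sum>x\<in>S. g x)"
  have g1: "1 \<le> g x" if "x \<in> S" for x using g that by (rule hitting_time_ge_1)
  have gG: "g x \<le> G" if "x \<in> S" for x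
    unfolding G_def using member_le_sum[of x S g] that finite_S g1 by fastforce
  have G1: "1 \<le> G" using S_nonempty g1 gG by fastforce
  \<comment> \<open>Zero on \<open>R\<close>: the next age is 2 whatever the current one, so a large
    age there is harmless.\<close>
  define V where "V h = (real (age h))\<^sup>2 * (if hd h \<in> R then 0 else g (hd h))" for h
  \<comment> \<open>Covers both cases of the drift: \<open>4 * G\<close> after a refresh and
    \<open>(1 + 2 * G) * G\<close> otherwise.\<close>
  define C where "C = (4 + 2 * G) * G"
  \<comment> \<open>From \<open>g \<le> G\<close>, \<open>avoid g = g - 1\<close> is at most
    \<open>(1 - 2 * \<epsilon>) * g\<close>. Half of this contraction pays for
    \<open>(a + 1)^2 \<le> (1 + \<epsilon>) * a^2 + 1 + 1 / \<epsilon>\<close>, leaving the rate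
    \<open>1 - \<epsilon>\<close>.\<close>
  define \<epsilon> where "\<epsilon> = 1 / (2 * G)"
  have e: "0 < \<epsilon>" "\<epsilon> \<le> 1" unfolding \<epsilon>_def using G1 by auto
  have step_g: "step (\<lambda>x. if x \<in> R then 0 else g x) x = avoid g x" for x
    by (simp add: step_if)
  have drift: "predict V h \<le> (1 - \<epsilon>) * V h + C" if h: "h \<in> histories m" for h m
  proof -
    have x: "hd h \<in> S" and ne: "h \<noteq> []" using history_hd[OF h] by auto
    have pV: "predict V h = (real (if hd h \<in> R then 2 else Suc (age h)))\<^sup>2 * avoid g (hd h)"
      using predict_age[OF ne, of "\<lambda>a. (real a)\<^sup>2" "\<lambda>x. if x \<in> R then 0 else g x"]
      unfolding V_def step_g .
    have ag: "avoid g (hd h) = g (hd h) - 1" using g[OF x] by simp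
    show ?thesis
    proof (cases "hd h \<in> R")
      case True
      have "4 * avoid g (hd h) \<le> 4 * G" using ag gG[OF x] by simp
      also have "\<dots> \<le> C" unfolding C_def using G1 by (intro mult_right_mono) auto
      finally show ?thesis unfolding pV V_def using True by simp
    next
      case False
      let ?a = "real (age h)"
      have "g (hd h) * (2 * \<epsilon>) \<le> 1" using gG[OF x] G1 unfolding \<epsilon>_def by simp
      then have ag': "avoid g (hd h) \<le> (1 - 2 * \<epsilon>) * g (hd h)" unfolding ag by (simp add: algebra_simps)
      have e2: "0 \<le> 1 - 2 * \<epsilon>" unfolding \<epsilon>_def using G1 by simp
      have "2 * ?a \<le> \<epsilon> * ?a\<^sup>2 + 1 / \<epsilon>"
      proof -
        have "0 \<le> (\<epsilon> * ?a - 1)\<^sup>2 / \<epsilon>" using e by simp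
        also have "\<dots> = \<epsilon> * ?a\<^sup>2 + 1 / \<epsilon> - 2 * ?a" using e by (simp add: field_simps power2_eq_square)
        finally show ?thesis by simp
      qed
      then have sq: "(?a + 1)\<^sup>2 \<le> (1 + \<epsilon>) * ?a\<^sup>2 + (1 + 2 * G)"
        unfolding \<epsilon>_def by (simp add: power2_sum algebra_simps)
      have "(?a + 1)\<^sup>2 * (1 - 2 * \<epsilon>) \<le> ((1 + \<epsilon>) * ?a\<^sup>2 + (1 + 2 * G)) * (1 - 2 * \<epsilon>)"
        using sq e2 by (rule mult_right_mono)
      also have "\<dots> \<le> (1 - \<epsilon>) * ?a\<^sup>2 + (1 + 2 * G)"
      proof -
        have "(1 + \<epsilon>) * (1 - 2 * \<epsilon>) \<le> 1 - \<epsilon>" by (simp add: algebra_simps)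
        then have "(1 + \<epsilon>) * (1 - 2 * \<epsilon>) * ?a\<^sup>2 \<le> (1 - \<epsilon>) * ?a\<^sup>2" by (rule mult_right_mono) simp
        moreover have "(1 + 2 * G) * (1 - 2 * \<epsilon>) \<le> (1 + 2 * G) * 1"
          using G1 e by (intro mult_left_mono) auto
        ultimately show ?thesis by (simp add: algebra_simps)
      qed
      finally have k: "(?a + 1)\<^sup>2 * (1 - 2 * \<epsilon>) \<le> (1 - \<epsilon>) * ?a\<^sup>2 + (1 + 2 * G)" .
      have "predict V h = (?a + 1)\<^sup>2 * avoid g (hd h)" unfolding pV using False by (simp add: add.commute)
      also have "\<dots> \<le> (?a + 1)\<^sup>2 * ((1 - 2 * \<epsilon>) * g (hd h))" using ag' by (rule mult_left_mono) simp
      also have "\<dots> = ((?a + 1)\<^sup>2 * (1 - 2 * \<epsilon>)) * g (hd h)" by simp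
      also have "\<dots> \<le> ((1 - \<epsilon>) * ?a\<^sup>2 + (1 + 2 * G)) * g (hd h)"
        using k g1[OF x] by (intro mult_right_mono) auto
      also have "\<dots> = (1 - \<epsilon>) * V h + (1 + 2 * G) * g (hd h)" unfolding V_def using False by (simp add: algebra_simps)
      also have "(1 + 2 * G) * g (hd h) \<le> C"
        unfolding C_def using gG[OF x] G1 g1[OF x] by (intro mult_mono) auto
      finally show ?thesis by simp
    qed
  qed
  \<comment> \<open>\<open>2 * G * C\<close> equals \<open>C / \<epsilon>\<close>, the fixed point
    of \<open>v = (1 - \<epsilon>) * v + C\<close>; the first summand accounts for the initial
    value.\<close>
  define B where "B = expectation (\<lambda>w. V (hist 0 w)) + 2 * G * C"
  have C0: "0 \<le> C" unfolding C_def using G1 by simp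
  have EV: "expectation (\<lambda>w. V (hist m w)) \<le> B" for m
  proof (induction m)
    case 0
    then show ?case unfolding B_def using C0 G1 by simp
  next
    case (Suc m)
    have "expectation (\<lambda>w. V (hist (Suc m) w)) = expectation (\<lambda>w. predict V (hist m w))"
      using expectation_predict[of "\<lambda>_. 1" m V] by (simp del: hist.simps)
    also have "\<dots> \<le> expectation (\<lambda>w. (1 - \<epsilon>) * V (hist m w) + C)"
      by (rule expectation_mono_hist) (rule drift)
    also have "\<dots> = (1 - \<epsilon>) * expectation (\<lambda>w. V (hist m w)) + C"
      by (simp add: prob_space)
    also have "\<dots> \<le> (1 - \<epsilon>) * B + C"
      using Suc e by (intro add_right_mono mult_left_mono) auto
    also have "\<dots> \<le> B"
    proof -
      have "0 \<le> expectation (\<lambda>w. V (hist 0 w))"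
      proof -
        have "expectation (\<lambda>w. 0) \<le> expectation (\<lambda>w. V (hist 0 w))"
        proof (rule expectation_mono_hist[where F="\<lambda>_. 0"])
          fix h assume "h \<in> histories 0"
          then show "0 \<le> V h" unfolding V_def using history_hd g1[of "hd h"] by auto
        qed
        then show ?thesis by simp
      qed
      then have "2 * G * C \<le> B" unfolding B_def by simp
      then have "\<epsilon> * (2 * G * C) \<le> \<epsilon> * B" using e by (intro mult_left_mono) auto
      moreover have "\<epsilon> * (2 * G * C) = C" unfolding \<epsilon>_def using G1 by simp
      ultimately have "C \<le> \<epsilon> * B" by linarith
      then show ?thesis by (simp add: algebra_simps)
    qed
    finally show ?case .
  qed
  \<comment> \<open>\<open>V\<close> ignores the age on \<open>R\<close>, so the age is expressed
    through the previous slot. The 6 covers the value 4 right after a refresh and the 2 from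
    \<open>(a + 1)^2 \<le> 2 + 2 * a^2\<close>.\<close>
  have "expectation (\<lambda>w. (real (age (hist m w)))\<^sup>2) \<le> 6 + 2 * \<bar>B\<bar>" for m
  proof (cases m)
    case 0
    then show ?thesis by (simp add: prob_space)
  next
    case (Suc k)
    have "expectation (\<lambda>w. (real (age (hist m w)))\<^sup>2)
       = expectation (\<lambda>w. (\<lambda>h. (real (if hd h \<in> R then 2 else Suc (age h)))\<^sup>2) (hist k w))"
      unfolding Suc age_hist_Suc by simp
    also have "\<dots> \<le> expectation (\<lambda>w. (\<lambda>h. 6 + 2 * V h) (hist k w))"
    proof (rule expectation_mono_hist)
      fix h assume h: "h \<in> histories k"
      then have x: "hd h \<in> S" using history_hd by auto
      show "(real (if hd h \<in> R then 2 else Suc (age h)))\<^sup>2 \<le> 6 + 2 * V h"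
      proof (cases "hd h \<in> R")
        case False
        let ?a = "real (age h)"
        have "?a\<^sup>2 * 1 \<le> V h" unfolding V_def using False mult_left_mono[OF g1[OF x], of "?a\<^sup>2"] by simp
        moreover have "(?a + 1)\<^sup>2 \<le> 2 + 2 * ?a\<^sup>2"
          using zero_le_power2[of "?a - 1"] by (simp add: power2_sum power2_diff)
        ultimately show ?thesis using False by (simp add: add.commute)
      qed (simp add: V_def)
    qed
    also have "\<dots> = 6 + 2 * expectation (\<lambda>w. V (hist k w))"
      by (simp add: prob_space)
    also have "\<dots> \<le> 6 + 2 * \<bar>B\<bar>" using EV[of k] by simp
    finally show ?thesis .
  qed
  then show thesis using that by blast
qed

lemma age_mean:
  assumes g: "\<And>x. x \<in> S \<Longrightarrow> g x = 1 + avoid g x"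
  shows "AE w in M. cesaro (\<lambda>s. real (age (hist s w))) \<longlonglongrightarrow> (\<Sum>x\<in>S. p x * g x) + 1"
proof -
  obtain B where B: "\<And>m. expectation (\<lambda>w. (real (age (hist m w)))\<^sup>2) \<le> B"
    using age_second_moment_bounded[OF g] by blast
  \<comment> \<open>Chosen so that \<open>step u = g\<close>: avoiding a refresh contributes
    \<open>avoid (1 + g)\<close> and hitting one contributes \<open>1 - avoid 1\<close>, together
    \<open>1 + avoid g\<close>.\<close>
  define u where "u x = (if x \<in> R then 1 else 1 + g x)" for x
  define U where "U = (\<Sum>x\<in>S. \<bar>u x\<bar>)"
  define \<phi> where "\<phi> h = real (age h) * u (hd h)" for h
  \<comment> \<open>The correction on \<open>R\<close> has \<open>p\<close>-sum 1 by Kac's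
    formula.\<close>
  have limit: "(\<Sum>x\<in>S. p x * (g x + (if x \<in> R then g x else 0))) = (\<Sum>x\<in>S. p x * g x) + 1"
  proof -
    have "(\<Sum>x\<in>S. p x * (if x \<in> R then g x else 0)) = (\<Sum>x\<in>R. p x * g x)"
      using R_subset finite_S by (intro sum.mono_neutral_cong_right) auto
    also have "\<dots> = (\<Sum>x\<in>S. p x * 1)" by (rule sum_refresh_eq_sum_stationary) (rule g)
    finally show ?thesis using p_sum by (simp add: distrib_left sum.distrib)
  qed
  have "expectation (\<lambda>w. (\<phi> (hist m w))\<^sup>2) \<le> U\<^sup>2 * B" for m
  proof -
    have "expectation (\<lambda>w. (\<phi> (hist m w))\<^sup>2) \<le> expectation (\<lambda>w. (\<lambda>h. U\<^sup>2 * (real (age h))\<^sup>2) (hist m w))"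
    proof (rule expectation_mono_hist)
      fix h assume "h \<in> histories m"
      then have "\<bar>u (hd h)\<bar> \<le> U"
        unfolding U_def using history_hd finite_S by (intro member_le_sum) auto
      from power_mono[OF this abs_ge_zero, of 2] have "(u (hd h))\<^sup>2 \<le> U\<^sup>2" by simp
      then show "(\<phi> h)\<^sup>2 \<le> U\<^sup>2 * (real (age h))\<^sup>2"
        unfolding \<phi>_def power_mult_distrib mult.commute[of "U\<^sup>2"] by (rule mult_left_mono) simp
    qed
    also have "\<dots> = U\<^sup>2 * expectation (\<lambda>w. (real (age (hist m w)))\<^sup>2)" by simp
    also have "\<dots> \<le> U\<^sup>2 * B" using B by (rule mult_left_mono) simp
    finally show ?thesis .
  qed
  then have "AE w in M. cesaro (\<lambda>s. \<phi> (hist s w) - predict \<phi> (hist s w)) \<longlonglongrightarrow> 0"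
    by (rule stationary_prediction_strong_law)
  moreover have "AE w in M. cesaro (\<lambda>s. (\<lambda>x. g x + (if x \<in> R then g x else 0)) (X s w))
      \<longlonglongrightarrow> (\<Sum>x\<in>S. p x * (g x + (if x \<in> R then g x else 0)))"
    by (rule function_frequency)
  ultimately show ?thesis using AE_space
  proof (eventually_elim, goal_cases)
    case (1 w)
    \<comment> \<open>The Poisson equation: off \<open>R\<close>,
      \<open>\<phi> - predict \<phi>\<close> is \<open>a * (1 + g) - (a + 1) * g = a - g\<close>; on
      \<open>R\<close> it is \<open>a - 2 * g\<close>. The remainder depends on the state
      alone.\<close>
    have "real (age (hist s w)) = (\<phi> (hist s w) - predict \<phi> (hist s w)) + (g (X s w) + (if X s w \<in> R then g (X s w) else 0))" for s
    proof -
      have x: "X s w \<in> S" using 1 by (intro X_range)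
      have "step u (X s w) = avoid (\<lambda>x. 1 + g x) (X s w) + (\<Sum>y\<in>R. P (X s w) y)"
        unfolding u_def step_if by simp
      also have "avoid (\<lambda>x. 1 + g x) (X s w) = avoid (\<lambda>_. 1) (X s w) + avoid g (X s w)"
        by (simp add: avoid_def distrib_left sum.distrib)
      finally have "step u (X s w) = g (X s w)"
        using sum_R_eq_one_minus_avoid[OF x] g[OF x] by simp
      then have "predict \<phi> (hist s w) = real (if X s w \<in> R then 2 else Suc (age (hist s w))) * g (X s w)"
        unfolding \<phi>_def by (subst predict_age) simp_all
      then show ?thesis unfolding \<phi>_def u_def by (simp add: algebra_simps)
    qed
    then have "cesaro (\<lambda>s. real (age (hist s w))) = (\<lambda>N. cesaro (\<lambda>s. \<phi> (hist s w) - predict \<phi> (hist s w)) N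
        + cesaro (\<lambda>s. g (X s w) + (if X s w \<in> R then g (X s w) else 0)) N)"
      by (simp only: sum.distrib add_divide_distrib)
    then show ?case using tendsto_add[OF 1(1) 1(2)] limit by simp
  qed
qed

text \<open>A bounded functional and its prediction have the same time average, and the prediction
  is expressed through the age one slot earlier; this gives the recursion over ages.\<close>

lemma age_frequency_from_prediction:
  fixes \<phi> :: "nat \<Rightarrow> real"
  assumes lim: "AE w in M. cesaro (\<lambda>s. \<phi> (if X s w \<in> R then 2 else Suc (age (hist s w))) * step f (X s w)) \<longlonglongrightarrow> L"
    and \<phi>: "\<And>a. \<bar>\<phi> a\<bar> \<le> 1"
  shows "AE w in M. cesaro (\<lambda>s. \<phi> (age (hist s w)) * f (X s w)) \<longlonglongrightarrow> L"
proof -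
  let ?\<phi> = "\<lambda>h. \<phi> (age h) * f (hd h)"
  have "AE w in M. cesaro (\<lambda>s. ?\<phi> (hist s w) - predict ?\<phi> (hist s w)) \<longlonglongrightarrow> 0"
  proof (rule stationary_prediction_strong_law, rule bounded_second_moment[where B="\<Sum>x\<in>S. \<bar>f x\<bar>"])
    fix m h assume "h \<in> histories m"
    then have "\<bar>f (hd h)\<bar> \<le> (\<Sum>x\<in>S. \<bar>f x\<bar>)"
      using history_hd finite_S by (intro member_le_sum) auto
    moreover have "\<bar>\<phi> (age h)\<bar> * \<bar>f (hd h)\<bar> \<le> 1 * \<bar>f (hd h)\<bar>"
      by (intro mult_right_mono \<phi>) simp
    ultimately show "\<bar>?\<phi> h\<bar> \<le> (\<Sum>x\<in>S. \<bar>f x\<bar>)" by (simp add: abs_mult)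
  qed
  with lim show ?thesis
  proof eventually_elim
    case (elim w)
    have pr: "predict ?\<phi> (hist s w) = \<phi> (if X s w \<in> R then 2 else Suc (age (hist s w))) * step f (X s w)" for s
      by (subst predict_age) simp_all
    from tendsto_add[OF elim] show ?case
      unfolding pr hd_hist by (simp only: add_divide_distrib[symmetric] sum.distrib[symmetric]) simp
  qed
qed

text \<open>The free \<open>f\<close> carries the induction. Age \<open>d + 3\<close> means age
  \<open>d + 2\<close> and no refresh one slot earlier, so \<open>f\<close> is replaced by
  \<open>step f\<close> cut to 0 on \<open>R\<close>, whose own \<open>step\<close> is
  \<open>avoid (step f)\<close>. Later \<open>f = 1\<close> yields the discretized age and the
  indicator of \<open>R\<close> the peak age.\<close>

lemma age_frequency:
  "AE w in M. cesaro (\<lambda>s. of_bool (age (hist s w) = d + 2) * f (X s w))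
      \<longlonglongrightarrow> (\<Sum>x\<in>R. p x * (avoid ^^ d) (step f) x)"
proof (induction d arbitrary: f)
  case 0
  show ?case
  proof (rule age_frequency_from_prediction[where \<phi>="\<lambda>a. of_bool (a = 0 + 2)"])
    have "AE w in M. cesaro (\<lambda>s. (\<lambda>x. of_bool (x \<in> R) * step f x) (X s w)) \<longlonglongrightarrow> (\<Sum>x\<in>S. p x * (of_bool (x \<in> R) * step f x))"
      by (rule function_frequency)
    moreover have "(\<Sum>x\<in>S. p x * (of_bool (x \<in> R) * step f x)) = (\<Sum>x\<in>R. p x * step f x)"
      using R_subset finite_S by (intro sum.mono_neutral_cong_right) auto
    moreover have "(of_bool ((if X s w \<in> R then 2 else Suc (age (hist s w))) = 0 + 2) :: real) = of_bool (X s w \<in> R)" for s w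
      using age_ge_2[of "hist s w"] by auto
    ultimately show "AE w in M. cesaro (\<lambda>s. of_bool ((if X s w \<in> R then 2 else Suc (age (hist s w))) = 0 + 2) * step f (X s w))
        \<longlonglongrightarrow> (\<Sum>x\<in>R. p x * (avoid ^^ 0) (step f) x)" by (simp only: funpow_0)
  qed auto
next
  case (Suc d)
  show ?case
  proof (rule age_frequency_from_prediction[where \<phi>="\<lambda>a. of_bool (a = Suc d + 2)"])
    let ?f = "\<lambda>x. if x \<in> R then 0 else step f x"
    have "step ?f = avoid (step f)"
      using step_if[of "\<lambda>_. 0" "step f"] by (simp add: fun_eq_iff)
    moreover have "(of_bool ((if X s w \<in> R then 2 else Suc (age (hist s w))) = Suc d + 2) :: real) * step f (X s w)
        = of_bool (age (hist s w) = d + 2) * ?f (X s w)" for s w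
      by auto
    ultimately show "AE w in M. cesaro (\<lambda>s. of_bool ((if X s w \<in> R then 2 else Suc (age (hist s w))) = Suc d + 2) * step f (X s w))
        \<longlonglongrightarrow> (\<Sum>x\<in>R. p x * (avoid ^^ Suc d) (step f) x)"
      using Suc.IH[of ?f] by (simp only: funpow_Suc_right o_def)
  qed auto
qed

end

section \<open>Age metrics of a sample path\<close>

lemma card_eq_sum_of_bool: "real (card {s. s < (N :: nat) \<and> Q s}) = (\<Sum>s<N. of_bool (Q s))"
proof -
  have "{s. s < N \<and> Q s} = {..<N} \<inter> {s. Q s}" by auto
  then show ?thesis by simp
qed

text \<open>Serves to discard the slots before the first refresh, where \<open>disc_aoi\<close> is
  \<open>None\<close>.\<close>

lemma cesaro_eventually_cong:
  assumes "\<And>s. K \<le> s \<Longrightarrow> f s = g s" and f: "cesaro f \<longlonglongrightarrow> L"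
  shows "cesaro g \<longlonglongrightarrow> L"
proof -
  have "(\<Sum>s<N. g s) = (\<Sum>s<N. f s) + (\<Sum>s<K. g s - f s)" if "K \<le> N" for N
  proof -
    have "(\<Sum>s<N. g s - f s) = (\<Sum>s<K. g s - f s)"
      using that assms(1) by (intro sum.mono_neutral_right) auto
    then show ?thesis by (simp add: sum_subtractf)
  qed
  then have "\<forall>\<^sub>F N in sequentially. cesaro f N + (\<Sum>s<K. g s - f s) / real N = cesaro g N"
    by (intro eventually_sequentiallyI[of K]) (simp only: add_divide_distrib)
  moreover have "(\<lambda>N. cesaro f N + (\<Sum>s<K. g s - f s) / real N) \<longlonglongrightarrow> L + 0"
    by (intro tendsto_add f lim_const_over_n)
  ultimately have "cesaro g \<longlonglongrightarrow> L + 0" by (rule Lim_transform_eventually[rotated])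
  then show ?thesis by (simp only: add_0_right)
qed

lemma cesaro_const: "cesaro (\<lambda>_. c) \<longlonglongrightarrow> c"
proof -
  have "\<forall>\<^sub>F N in sequentially. c = cesaro (\<lambda>_. c) N"
    by (intro eventually_sequentiallyI[of 1]) simp
  then show ?thesis by (rule Lim_transform_eventually[OF tendsto_const])
qed

lemma last_refresh_less:
  assumes "\<exists>r<s. refresh x r"
  shows "Max {r. r < s \<and> refresh x r} < s"
  using Max_in[of "{r. r < s \<and> refresh x r}"] assms by auto

text \<open>The first refresh erases the initial value of \<open>A\<close>, so every sequence
  obeying the recursion agrees with the true age from then on.\<close>

lemma disc_aoi_eq_Some:
  assumes A: "\<And>s. A (Suc s) = (if refresh x s then 2 else Suc (A s))"
  shows "\<exists>r<s. refresh x r \<Longrightarrow> disc_aoi x s = Some (A s)"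
proof (induction s)
  case (Suc s)
  show ?case
  proof (cases "refresh x s")
    case True
    have "Max {r. r < Suc s \<and> refresh x r} = s"
      using True by (intro Max_eqI) auto
    then show ?thesis using True A Suc.prems by (simp add: disc_aoi_def)
  next
    case False
    then have ex: "\<exists>r<s. refresh x r" using Suc.prems less_Suc_eq by auto
    have "{r. r < Suc s \<and> refresh x r} = {r. r < s \<and> refresh x r}"
      using False less_Suc_eq by auto
    then show ?thesis
      using Suc.IH[OF ex] Suc.prems False A last_refresh_less[OF ex] ex
      by (auto simp: disc_aoi_def Suc_diff_le)
  qed
qed simp

text \<open>On \<open>[s, s + 1)\<close> the refreshes completed by time \<open>t\<close> are
  exactly those of slots before \<open>s\<close>. The age rises from \<open>a - 1\<close> towards
  \<open>a\<close>, the end-of-slot value before a possible reset.\<close>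

lemma cont_aoi_slot:
  assumes "real s \<le> t" "t < real s + 1"
  shows "cont_aoi x t = (case disc_aoi x s of None \<Rightarrow> 0 | Some a \<Rightarrow> t - real s + (real a - 1))"
proof -
  have eq: "real r + 1 \<le> t \<longleftrightarrow> r < s" for r using assms by linarith
  show ?thesis
  proof (cases "\<exists>r<s. refresh x r")
    case True
    then show ?thesis
      using last_refresh_less[OF True] by (auto simp: cont_aoi_def disc_aoi_def eq of_nat_diff)
  next
    case False
    then show ?thesis by (auto simp: cont_aoi_def disc_aoi_def eq)
  qed
qed

text \<open>Linear growth from \<open>a - 1\<close> to \<open>a\<close> averages to
  \<open>a - 1/2\<close>. The right endpoint, where a refresh makes the age jump, is discarded by
  comparing on the open slot.\<close>

lemma cont_aoi_has_integral:
  "(cont_aoi x has_integral (case disc_aoi x s of None \<Rightarrow> 0 | Some a \<Rightarrow> real a - 1/2)) {real s..real s + 1}"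
proof (cases "disc_aoi x s")
  case None
  have "((\<lambda>t. 0) has_integral 0) (cbox (real s) (real s + 1))" by simp
  then have "(cont_aoi x has_integral 0) (cbox (real s) (real s + 1))"
    by (rule has_integral_spike_interior) (auto simp: cont_aoi_slot[of s] None)
  then show ?thesis using None by simp
next
  case (Some a)
  have "((\<lambda>t. t + (real a - 1 - real s)) has_integral
      ((real s + 1)\<^sup>2 - (real s)\<^sup>2) / 2 + measure lborel {real s..real s + 1} *\<^sub>R (real a - 1 - real s)) {real s..real s + 1}"
    by (intro has_integral_add ident_has_integral has_integral_const_real) auto
  then have "((\<lambda>t. t + (real a - 1 - real s)) has_integral (real a - 1/2)) (cbox (real s) (real s + 1))"
    by (simp add: power2_eq_square field_simps)
  then have "(cont_aoi x has_integral (real a - 1/2)) (cbox (real s) (real s + 1))"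
    by (rule has_integral_spike_interior) (auto simp: cont_aoi_slot[of s] Some)
  then show ?thesis using Some by simp
qed

text \<open>Inside the slot the age stays strictly between \<open>a - 1\<close> and
  \<open>a\<close>, so it exceeds an integer threshold throughout or nowhere.\<close>

lemma violation_has_integral:
  "((\<lambda>t. if real \<theta> < cont_aoi x t then 1 else 0 :: real) has_integral
      (case disc_aoi x s of None \<Rightarrow> 0 | Some a \<Rightarrow> of_bool (\<theta> < a))) {real s..real s + 1}"
proof -
  define c :: real where "c = (case disc_aoi x s of None \<Rightarrow> 0 | Some a \<Rightarrow> of_bool (\<theta> < a))"
  have "((\<lambda>t. c) has_integral measure lborel {real s..real s + 1} *\<^sub>R c) {real s..real s + 1}"
    by (rule has_integral_const_real)
  then have "((\<lambda>t. c) has_integral c) (cbox (real s) (real s + 1))" by simp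
  then have "((\<lambda>t. if real \<theta> < cont_aoi x t then 1 else 0 :: real) has_integral c) (cbox (real s) (real s + 1))"
  proof (rule has_integral_spike_interior)
    fix t assume "t \<in> box (real s) (real s + 1)"
    then have t: "real s < t" "t < real s + 1" by auto
    show "(if real \<theta> < cont_aoi x t then 1 else 0 :: real) = c"
    proof (cases "disc_aoi x s")
      case None
      then show ?thesis using t by (simp add: cont_aoi_slot[of s] c_def)
    next
      case (Some a)
      have "real \<theta> < t - real s + (real a - 1) \<longleftrightarrow> \<theta> < a"
      proof
        assume "\<theta> < a"
        then have "real \<theta> + 1 \<le> real a" by linarith
        then show "real \<theta> < t - real s + (real a - 1)" using t by linarith
      qed (use t in linarith)
      then show ?thesis using t Some by (simp add: cont_aoi_slot[of s] c_def)
    qed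
  qed
  then show ?thesis by (simp add: c_def)
qed

text \<open>Nonnegativity sandwiches the integral up to \<open>\<tau>\<close> between integrals over
  whole numbers of slots, and both slot counts divided by \<open>\<tau>\<close> tend to 1.\<close>

lemma time_average_tendsto:
  fixes f :: "real \<Rightarrow> real"
  assumes slot: "\<And>s. (f has_integral I s) {real s..real s + 1}"
    and nonneg: "\<And>t. 0 \<le> t \<Longrightarrow> 0 \<le> f t"
    and lim: "cesaro I \<longlonglongrightarrow> L"
  shows "((\<lambda>\<tau>. integral {0..\<tau>} f / \<tau>) \<longlongrightarrow> L) at_top"
proof -
  have int: "(f has_integral (\<Sum>s<N. I s)) {0..real N}" for N
  proof (induction N)
    case (Suc N)
    have "(f has_integral (\<Sum>s<N. I s) + I N) {0..real N + 1}"
      by (rule has_integral_combine[OF _ _ Suc slot]) auto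
    then show ?case by (simp add: add.commute)
  qed (use has_integral_refl(2)[of f 0] in simp)
  let ?N = "\<lambda>\<tau>::real. nat \<lfloor>\<tau>\<rfloor>"
  have flr: "real (?N \<tau>) \<le> \<tau>" "\<tau> < real (?N \<tau>) + 1" if "1 \<le> \<tau>" for \<tau> :: real
    using that by linarith+
  have ceil: "\<tau> \<le> real (Suc (?N \<tau>))" if "1 \<le> \<tau>" for \<tau> :: real
    using flr[OF that] by linarith
  have intf: "f integrable_on {0..\<tau>}" if "1 \<le> \<tau>" for \<tau> :: real
    by (rule integrable_on_subinterval[OF has_integral_integrable[OF int[of "Suc (?N \<tau>)"]]])
       (use ceil[OF that] in \<open>auto simp del: of_nat_Suc\<close>)
  have rescale: "cesaro I K * (real K / \<tau>) = (\<Sum>s<K. I s) / \<tau>" for K \<tau>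
    by (cases "K = 0") auto
  have N: "filterlim ?N sequentially at_top"
    by (rule filterlim_compose[OF filterlim_nat_sequentially filterlim_floor_sequentially])
  have ratio: "((\<lambda>\<tau>. real (?N \<tau>) / \<tau>) \<longlongrightarrow> 1) at_top"
  proof (rule tendsto_sandwich)
    show "((\<lambda>\<tau>::real. (\<tau> - 1) / \<tau>) \<longlongrightarrow> 1) at_top" by real_asymp
    show "((\<lambda>\<tau>::real. 1) \<longlongrightarrow> 1) at_top" by simp
    show "\<forall>\<^sub>F \<tau> in at_top. (\<tau> - 1) / \<tau> \<le> real (?N \<tau>) / \<tau>"
      using eventually_ge_at_top[of "1::real"]
    proof eventually_elim
      case (elim \<tau>)
      show ?case using flr[OF elim] elim by (intro divide_right_mono) auto
    qed
    show "\<forall>\<^sub>F \<tau> in at_top. real (?N \<tau>) / \<tau> \<le> 1"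
      using eventually_ge_at_top[of "1::real"]
    proof eventually_elim
      case (elim \<tau>)
      show ?case using flr[OF elim] elim by simp
    qed
  qed
  have ratio': "((\<lambda>\<tau>. real (Suc (?N \<tau>)) / \<tau>) \<longlongrightarrow> 1) at_top"
  proof -
    have "((\<lambda>\<tau>::real. 1 / \<tau>) \<longlongrightarrow> 0) at_top" by real_asymp
    from tendsto_add[OF ratio this] show ?thesis by (simp add: add_divide_distrib add.commute)
  qed
  show ?thesis
  proof (rule tendsto_sandwich)
    show "((\<lambda>\<tau>. cesaro I (?N \<tau>) * (real (?N \<tau>) / \<tau>)) \<longlongrightarrow> L) at_top"
      using tendsto_mult[OF filterlim_compose[OF lim N] ratio] by simp
    show "((\<lambda>\<tau>. cesaro I (Suc (?N \<tau>)) * (real (Suc (?N \<tau>)) / \<tau>)) \<longlongrightarrow> L) at_top"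
      using tendsto_mult[OF filterlim_compose[OF LIMSEQ_Suc[OF lim] N] ratio'] by (simp del: sum.lessThan_Suc)
    show "\<forall>\<^sub>F \<tau> in at_top. cesaro I (?N \<tau>) * (real (?N \<tau>) / \<tau>) \<le> integral {0..\<tau>} f / \<tau>"
      using eventually_ge_at_top[of "1::real"]
    proof eventually_elim
      case (elim \<tau>)
      have "(\<Sum>s<?N \<tau>. I s) = integral {0..real (?N \<tau>)} f" by (rule integral_unique[OF int, symmetric])
      also have "\<dots> \<le> integral {0..\<tau>} f"
      proof (rule integral_subset_le)
        show "f integrable_on {0..\<tau>}" by (rule intf[OF elim])
        show "f integrable_on {0..real (?N \<tau>)}" by (rule has_integral_integrable[OF int])
      qed (use flr[OF elim] nonneg in auto)
      finally show ?case unfolding rescale using elim by (intro divide_right_mono) auto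
    qed
    show "\<forall>\<^sub>F \<tau> in at_top. integral {0..\<tau>} f / \<tau> \<le> cesaro I (Suc (?N \<tau>)) * (real (Suc (?N \<tau>)) / \<tau>)"
      using eventually_ge_at_top[of "1::real"]
    proof eventually_elim
      case (elim \<tau>)
      have "integral {0..\<tau>} f \<le> integral {0..real (Suc (?N \<tau>))} f"
      proof (rule integral_subset_le)
        show "f integrable_on {0..\<tau>}" by (rule intf[OF elim])
        show "f integrable_on {0..real (Suc (?N \<tau>))}" by (rule has_integral_integrable[OF int])
      qed (use ceil[OF elim] nonneg in \<open>auto simp del: of_nat_Suc\<close>)
      also have "\<dots> = (\<Sum>s<Suc (?N \<tau>). I s)" using int by (rule integral_unique)
      finally show ?case unfolding rescale using elim by (intro divide_right_mono) auto
    qed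
  qed
qed

text \<open>What a typical sample path satisfies; inside this locale nothing is random. Per slot,
  \<open>c d\<close> is the frequency of age \<open>d + 2\<close> and \<open>e d\<close> that of age
  \<open>d + 2\<close> together with a refresh; \<open>m\<close> is the mean age.\<close>

locale aoi_path =
  fixes x :: "nat \<Rightarrow> state" and A :: "nat \<Rightarrow> nat" and \<rho> m :: real and c e :: "nat \<Rightarrow> real"
  assumes A0: "2 \<le> A 0" and A_Suc: "\<And>s. A (Suc s) = (if refresh x s then 2 else Suc (A s))"
    and refresh_rate: "cesaro (\<lambda>s. of_bool (refresh x s)) \<longlonglongrightarrow> \<rho>" "0 < \<rho>"
    and age_rate: "\<And>d. cesaro (\<lambda>s. of_bool (A s = d + 2)) \<longlonglongrightarrow> c d"
    and peak_rate: "\<And>d. cesaro (\<lambda>s. of_bool (A s = d + 2 \<and> refresh x s)) \<longlonglongrightarrow> e d"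
    and mean_age: "cesaro (\<lambda>s. real (A s)) \<longlonglongrightarrow> m"
begin

lemma A_ge_2: "2 \<le> A s"
  using A0 by (induction s) (auto simp: A_Suc)

lemma eventually_disc_aoi: "\<exists>K. \<forall>s\<ge>K. disc_aoi x s = Some (A s)"
proof -
  have "\<exists>r. refresh x r"
  proof (rule ccontr)
    assume "\<not> ?thesis"
    then have "cesaro (\<lambda>s. of_bool (refresh x s)) = (\<lambda>_. 0 :: real)" by simp
    then show False using refresh_rate by (simp add: LIMSEQ_const_iff)
  qed
  then obtain r where "refresh x r" by blast
  then have "\<forall>s\<ge>Suc r. disc_aoi x s = Some (A s)"
    by (intro allI impI disc_aoi_eq_Some[OF A_Suc] exI[of _ r]) simp
  then show ?thesis by blast
qed

lemma cesaro_disc_aoi: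
  assumes "cesaro (\<lambda>s. F s (Some (A s))) \<longlonglongrightarrow> L"
  shows "cesaro (\<lambda>s. F s (disc_aoi x s)) \<longlonglongrightarrow> L"
proof -
  obtain K where "\<forall>s\<ge>K. disc_aoi x s = Some (A s)" using eventually_disc_aoi by blast
  then show ?thesis by (intro cesaro_eventually_cong[OF _ assms, of K]) auto
qed

lemma disc_frac_tendsto: "disc_frac x (d + 2) \<longlonglongrightarrow> c d"
proof -
  have "cesaro (\<lambda>s. (\<lambda>s a. of_bool (a = Some (d + 2))) s (disc_aoi x s)) \<longlonglongrightarrow> c d"
    by (rule cesaro_disc_aoi) (use age_rate[of d] in simp)
  then show ?thesis unfolding disc_frac_def[abs_def] card_eq_sum_of_bool by simp
qed

text \<open>Peak ages are the discretized ages of refresh slots, so the fraction is a quotient of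
  two slot frequencies.\<close>

lemma peak_frac_tendsto: "peak_frac x (d + 2) \<longlonglongrightarrow> e d / \<rho>"
proof -
  have "cesaro (\<lambda>s. (\<lambda>s a. of_bool (refresh x s \<and> a = Some (d + 2))) s (disc_aoi x s)) \<longlonglongrightarrow> e d"
    by (rule cesaro_disc_aoi) (use peak_rate[of d] in \<open>simp add: conj_commute\<close>)
  moreover have "cesaro (\<lambda>s. (\<lambda>s a. of_bool (refresh x s \<and> a \<noteq> None)) s (disc_aoi x s)) \<longlonglongrightarrow> \<rho>"
    by (rule cesaro_disc_aoi) (use refresh_rate(1) in simp)
  ultimately have "(\<lambda>N. cesaro (\<lambda>s. of_bool (refresh x s \<and> disc_aoi x s = Some (d + 2))) N
      / cesaro (\<lambda>s. of_bool (refresh x s \<and> disc_aoi x s \<noteq> None)) N) \<longlonglongrightarrow> e d / \<rho>"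
    using refresh_rate(2) by (intro tendsto_divide) auto
  moreover have "\<forall>\<^sub>F N in sequentially. cesaro (\<lambda>s. of_bool (refresh x s \<and> disc_aoi x s = Some (d + 2))) N
      / cesaro (\<lambda>s. of_bool (refresh x s \<and> disc_aoi x s \<noteq> None)) N = peak_frac x (d + 2) N"
    by (intro eventually_sequentiallyI[of 1]) (simp add: peak_frac_def card_eq_sum_of_bool)
  ultimately show ?thesis by (rule Lim_transform_eventually)
qed

lemma cont_aoi_nonneg: "0 \<le> t \<Longrightarrow> 0 \<le> cont_aoi x t"
proof -
  assume "0 \<le> t"
  then have "real (nat \<lfloor>t\<rfloor>) \<le> t" "t < real (nat \<lfloor>t\<rfloor>) + 1" by linarith+
  moreover have "1 \<le> a" if "disc_aoi x s = Some a" for s a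
    using that by (auto simp: disc_aoi_def split: if_splits)
  ultimately show ?thesis
    by (cases "disc_aoi x (nat \<lfloor>t\<rfloor>)") (auto simp: cont_aoi_slot[of "nat \<lfloor>t\<rfloor>"] intro!: add_nonneg_nonneg)
qed

lemma avg_aoi_tendsto: "(avg_aoi x \<longlongrightarrow> m - 1/2) at_top"
  unfolding avg_aoi_def[abs_def]
proof (rule time_average_tendsto[OF cont_aoi_has_integral cont_aoi_nonneg])
  have "cesaro (\<lambda>s. (\<lambda>s a. case a of None \<Rightarrow> 0 | Some a \<Rightarrow> real a - 1/2) s (disc_aoi x s)) \<longlonglongrightarrow> m - 1/2"
  proof (rule cesaro_disc_aoi)
    show "cesaro (\<lambda>s. case Some (A s) of None \<Rightarrow> 0 | Some a \<Rightarrow> real a - 1/2) \<longlonglongrightarrow> m - 1/2"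
      using tendsto_diff[OF mean_age cesaro_const[of "1/2"]]
      by (simp only: option.case sum_subtractf diff_divide_distrib)
  qed
  then show "cesaro (\<lambda>s. case disc_aoi x s of None \<Rightarrow> 0 | Some a \<Rightarrow> real a - 1/2) \<longlonglongrightarrow> m - 1/2" .
qed

lemma viol_frac_tendsto:
  assumes "1 \<le> \<theta>"
  shows "(viol_frac x (real \<theta>) \<longlongrightarrow> 1 - (\<Sum>d<\<theta> - 1. c d)) at_top"
  unfolding viol_frac_def[abs_def]
proof (rule time_average_tendsto[OF violation_has_integral])
  \<comment> \<open>Ages start at 2, so an age of at most \<open>\<theta>\<close> is
    \<open>d + 2\<close> for exactly one \<open>d < \<theta> - 1\<close>.\<close>
  have "of_bool (\<theta> < A s) = 1 - (\<Sum>d<\<theta> - 1. of_bool (A s = d + 2) :: real)" for s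
  proof -
    have "(\<Sum>d<\<theta> - 1. of_bool (A s = d + 2) :: real) = (\<Sum>d<\<theta> - 1. if d = A s - 2 then 1 else 0)"
      using A_ge_2[of s] by (intro sum.cong) auto
    then show ?thesis using A_ge_2[of s] assms by auto
  qed
  then have eq: "cesaro (\<lambda>s. of_bool (\<theta> < A s)) = (\<lambda>N. cesaro (\<lambda>_. 1) N - (\<Sum>d<\<theta> - 1. cesaro (\<lambda>s. of_bool (A s = d + 2)) N))"
    by (simp only: sum_subtractf diff_divide_distrib cesaro_sum)
  have "(\<lambda>N. cesaro (\<lambda>_. 1) N - (\<Sum>d<\<theta> - 1. cesaro (\<lambda>s. of_bool (A s = d + 2)) N)) \<longlonglongrightarrow> 1 - (\<Sum>d<\<theta> - 1. c d)"
    by (rule tendsto_diff[OF cesaro_const tendsto_sum]) (rule age_rate)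
  from this[folded eq] have "cesaro (\<lambda>s. of_bool (\<theta> < A s)) \<longlonglongrightarrow> 1 - (\<Sum>d<\<theta> - 1. c d)" .
  then have "cesaro (\<lambda>s. (\<lambda>s a. case a of None \<Rightarrow> 0 | Some a \<Rightarrow> of_bool (\<theta> < a)) s (disc_aoi x s)) \<longlonglongrightarrow> 1 - (\<Sum>d<\<theta> - 1. c d)"
    using cesaro_disc_aoi[of "\<lambda>s a. case a of None \<Rightarrow> 0 | Some a \<Rightarrow> of_bool (\<theta> < a)"] by (simp only: option.case)
  then show "cesaro (\<lambda>s. case disc_aoi x s of None \<Rightarrow> 0 | Some a \<Rightarrow> of_bool (\<theta> < a)) \<longlonglongrightarrow> 1 - (\<Sum>d<\<theta> - 1. c d)" .
qed simp

end

section \<open>The transition kernel\<close>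

lemma sum_Pair: "(\<Sum>x\<in>{a} \<times> B. f x) = (\<Sum>b\<in>B. f (a, b))"
proof -
  have "{a} \<times> B = Pair a ` B" by blast
  moreover have inj_on_Pair: "inj_on (Pair a) B" by (simp add: inj_on_def)
  ultimately show ?thesis by (simp only: sum.reindex[OF inj_on_Pair] o_def)
qed

lemma states_eq: "states E = {XS} \<times> {..E} \<union> {XF} \<times> {..E}"
proof -
  have "x = XS \<or> x = XF" for x by (cases x) auto
  then show ?thesis unfolding states_def by fastforce
qed

lemma sum_states: "(\<Sum>s\<in>states E. f s) = (\<Sum>b\<le>E. f (XS, b)) + (\<Sum>b\<le>E. f (XF, b))"
  unfolding states_eq by (subst sum.union_disjoint) (auto simp: sum_Pair)

lemma finite_states: "finite (states E)"
  unfolding states_eq by simp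

locale policy =
  fixes E :: nat and \<alpha> \<gamma> :: real and \<pi> :: "nat \<Rightarrow> nat \<Rightarrow> real" and \<omega> :: "nat \<Rightarrow> real"
  assumes \<alpha>: "0 < \<alpha>" "\<alpha> \<le> 1" and \<gamma>: "0 < \<gamma>" "\<gamma> \<le> 1"
    and \<pi>_range: "\<And>b bt. b \<le> E \<Longrightarrow> bt \<le> b \<Longrightarrow> 0 \<le> \<pi> b bt \<and> \<pi> b bt \<le> 1"
    and \<pi>_sum: "\<And>b. b \<le> E \<Longrightarrow> (\<Sum>bt\<le>b. \<pi> b bt) = 1"
    and \<pi>_zero: "\<And>b bt. bt > b \<Longrightarrow> \<pi> b bt = 0"
    and \<omega>_range: "\<And>bt. bt \<le> E \<Longrightarrow> 0 \<le> \<omega> bt \<and> \<omega> bt \<le> 1"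
begin

lemma rho_nonneg: "b \<le> E \<Longrightarrow> 0 \<le> rho \<alpha> \<pi> b j"
  using \<alpha> \<pi>_range[of b "nat j"] \<pi>_zero[of b "nat j"]
  by (cases "nat j \<le> b") (auto simp: rho_def)

lemma rho_outside: "j < 0 \<or> int b < j \<Longrightarrow> rho \<alpha> \<pi> b j = 0"
  using \<pi>_zero[of b "nat j"] by (auto simp: rho_def zless_nat_eq_int_zless)

lemma rho_sum:
  assumes "b' \<le> E"
  shows "(\<Sum>b\<le>E. rho \<alpha> \<pi> b' (int b' - int b)) = 1"
proof -
  have "(\<Sum>b\<le>E. rho \<alpha> \<pi> b' (int b' - int b)) = (\<Sum>b\<le>b'. rho \<alpha> \<pi> b' (int b' - int b))"
    using assms by (intro sum.mono_neutral_right) (auto intro: rho_outside)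
  also have "\<dots> = (\<Sum>j\<le>b'. rho \<alpha> \<pi> b' (int j))"
    by (rule sum.reindex_bij_witness[of _ "\<lambda>j. b' - j" "\<lambda>b. b' - b"]) (auto simp: of_nat_diff)
  also have "\<dots> = (\<Sum>j\<le>b'. \<alpha> * \<pi> b' j + (1 - \<alpha>) * (if j = 0 then 1 else 0))"
    by (simp add: rho_def)
  also have "\<dots> = \<alpha> * (\<Sum>j\<le>b'. \<pi> b' j) + (1 - \<alpha>) * (\<Sum>j\<le>b'. if j = 0 then 1 else 0)"
    by (simp only: sum.distrib sum_distrib_left)
  also have "\<dots> = 1" using \<pi>_sum[OF assms] by simp
  finally show ?thesis .
qed

text \<open>The mass that harvesting moves up one level equals the mass removed by the factor
  \<open>1 - \<gamma> * notEE\<close>. Both ends are harmless: at \<open>b = 0\<close> more than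
  \<open>b'\<close> units would be sent, and at \<open>b = E\<close> the term on the right vanishes
  through \<open>rho\<close> or, if \<open>b' = E\<close>, through \<open>notEE\<close>.\<close>

lemma rho_shifted_sum:
  assumes "b' \<le> E"
  shows "(\<Sum>b\<le>E. rho \<alpha> \<pi> b' (int b' - int b + 1)) = (\<Sum>b\<le>E. notEE E b' b * rho \<alpha> \<pi> b' (int b' - int b))"
proof -
  have "(\<Sum>b\<le>E. rho \<alpha> \<pi> b' (int b' - int b + 1)) = (\<Sum>b<E. rho \<alpha> \<pi> b' (int b' - int b))"
    by (subst sum.atMost_shift) (simp add: rho_outside)
  also have "\<dots> = (\<Sum>b<E. notEE E b' b * rho \<alpha> \<pi> b' (int b' - int b))"
    by (intro sum.cong) (auto simp: notEE_def)
  also have "\<dots> = (\<Sum>b\<le>E. notEE E b' b * rho \<alpha> \<pi> b' (int b' - int b))"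
    using assms by (subst lessThan_Suc_atMost[symmetric]) (auto simp: notEE_def intro!: rho_outside)
  finally show ?thesis .
qed

text \<open>Adding the two outcomes eliminates \<open>\<omega>\<close>; what remains is the battery
  kernel.\<close>

lemma trans_sum:
  assumes "s' \<in> states E"
  shows "(\<Sum>s\<in>states E. trans E \<alpha> \<gamma> \<pi> \<omega> s' s) = 1"
proof -
  obtain x' b' where s': "s' = (x', b')" by (cases s')
  have b': "b' \<le> E" using assms by (auto simp: s' states_def)
  let ?r = "rho \<alpha> \<pi> b'"
  have "trans E \<alpha> \<gamma> \<pi> \<omega> s' (XS, b) + trans E \<alpha> \<gamma> \<pi> \<omega> s' (XF, b)
      = ?r (int b' - int b) - \<gamma> * (notEE E b' b * ?r (int b' - int b)) + \<gamma> * ?r (int b' - int b + 1)" for b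
    by (simp add: trans_def s' Let_def algebra_simps)
  then have "(\<Sum>s\<in>states E. trans E \<alpha> \<gamma> \<pi> \<omega> s' s)
      = (\<Sum>b\<le>E. ?r (int b' - int b)) - \<gamma> * (\<Sum>b\<le>E. notEE E b' b * ?r (int b' - int b)) + \<gamma> * (\<Sum>b\<le>E. ?r (int b' - int b + 1))"
    unfolding sum_states by (simp only: sum.distrib[symmetric] sum_subtractf[symmetric] sum_distrib_left)
  then show ?thesis using rho_sum[OF b'] rho_shifted_sum[OF b'] by simp
qed

lemma trans_nonneg:
  assumes "s' \<in> states E" "s \<in> states E"
  shows "0 \<le> trans E \<alpha> \<gamma> \<pi> \<omega> s' s"
proof -
  obtain x' b' x b where s: "s' = (x', b')" "s = (x, b)" by (cases s', cases s)
  have b: "b' \<le> E" "b \<le> E" using assms by (auto simp: s states_def)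
  define k where "k = int b' - int b"
  define w where "w = (if k < 0 then 0 else \<omega> (nat k))"
  have w: "0 \<le> w" "w \<le> 1" using \<omega>_range[of "nat k"] b unfolding w_def k_def by auto
  have c: "0 \<le> 1 - \<gamma> * notEE E b' b" using \<gamma> by (simp add: notEE_def)
  have r: "0 \<le> rho \<alpha> \<pi> b' j" for j using b(1) by (rule rho_nonneg)
  \<comment> \<open>\<open>\<omega>\<close> is confined to the unit interval only up to index
    \<open>E\<close>; for indices beyond \<open>b'\<close> the factor \<open>rho\<close> is
    zero.\<close>
  have r1: "0 \<le> \<omega> (nat (k + 1)) * rho \<alpha> \<pi> b' (k + 1) \<and> 0 \<le> (1 - \<omega> (nat (k + 1))) * rho \<alpha> \<pi> b' (k + 1)"
  proof (cases "k + 1 \<le> int b'")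
    case True
    then have "nat (k + 1) \<le> E" using b by linarith
    then show ?thesis using \<omega>_range[of "nat (k + 1)"] r by (auto intro: mult_nonneg_nonneg)
  next
    case False
    then show ?thesis by (simp add: rho_outside)
  qed
  show ?thesis
    unfolding trans_def s fst_conv snd_conv Let_def k_def[symmetric] w_def[symmetric]
    using w c r r1 \<gamma> by (cases x) auto
qed

end

section \<open>Matrix form\<close>

definition state_count :: "nat \<Rightarrow> nat" where
  "state_count E = 2 * E + 2"

text \<open>State functions as vectors in the index order of the matrix; under this dictionary
  \<open>T\<close> becomes \<open>avoid\<close>.\<close>

definition fvec :: "nat \<Rightarrow> (state \<Rightarrow> real) \<Rightarrow> real vec" where
  "fvec E f = vec (state_count E) (\<lambda>i. f (idx_state E i))"

lemma fvec_carrier [simp]: "fvec E f \<in> carrier_vec (state_count E)"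
  by (simp add: fvec_def)

lemma idx_state_in_states: "i < state_count E \<Longrightarrow> idx_state E i \<in> states E"
  by (auto simp: idx_state_def states_def state_count_def)

lemma fvec_cong:
  assumes "\<And>s. s \<in> states E \<Longrightarrow> f s = g s"
  shows "fvec E f = fvec E g"
  by (intro eq_vecI) (simp_all add: fvec_def assms idx_state_in_states)

lemma fvec_surj:
  assumes "v \<in> carrier_vec (state_count E)"
  obtains f where "v = fvec E f"
proof
  show "v = fvec E (\<lambda>(x, b). case x of XS \<Rightarrow> v $ b | XF \<Rightarrow> v $ (E + 1 + b))"
    using assms by (intro eq_vecI) (auto simp: fvec_def idx_state_def state_count_def)
qed

lemma fvec_inj:
  assumes "fvec E f = fvec E g" "s \<in> states E"
  shows "f s = g s"
proof -
  obtain x b where s: "s = (x, b)" "b \<le> E" using assms(2) by (cases s) (auto simp: states_def)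
  define i where "i = (case x of XS \<Rightarrow> b | XF \<Rightarrow> E + 1 + b)"
  have "i < state_count E" "idx_state E i = s"
    using s by (auto simp: i_def idx_state_def state_count_def split: xstate.splits)
  moreover have "fvec E f $ i = fvec E g $ i" using assms(1) by simp
  ultimately show ?thesis by (simp add: fvec_def)
qed

lemma ones_eq_fvec: "ones (state_count E) = fvec E (\<lambda>_. 1)"
  by (simp add: ones_def fvec_def)

lemma minv_inverts:
  assumes "invertible_mat A"
  shows "minv A \<in> carrier_mat (dim_row A) (dim_row A)" "A * minv A = 1\<^sub>m (dim_row A)"
proof -
  obtain B where sq: "dim_col A = dim_row A" and B: "inverts_mat A B" "inverts_mat B A"
    using assms by (auto simp: invertible_mat_def)
  \<comment> \<open>\<open>invertible_mat\<close> fixes no dimensions for the inverse; they are read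
    off the two identity products.\<close>
  have "dim_col B = dim_row A"
    using arg_cong[OF B(1)[unfolded inverts_mat_def], of dim_col] by simp
  moreover have "dim_row B = dim_row A"
    using arg_cong[OF B(2)[unfolded inverts_mat_def], of dim_col] sq by simp
  ultimately have "\<exists>B. B \<in> carrier_mat (dim_row A) (dim_row A) \<and> inverts_mat A B \<and> inverts_mat B A"
    using B by (intro exI[of _ B]) auto
  from someI_ex[OF this]
  show "minv A \<in> carrier_mat (dim_row A) (dim_row A)" "A * minv A = 1\<^sub>m (dim_row A)"
    by (auto simp: minv_def inverts_mat_def)
qed

text \<open>Abel summation. If \<open>C d\<close> is the probability that a positive integer
  variable exceeds \<open>d\<close>, both sides are the mean of its minimum with
  \<open>k\<close>.\<close>

lemma truncated_mean_telescopes: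
  fixes C :: "nat \<Rightarrow> real"
  shows "(\<Sum>y = 1..k. real y * (C (y - 1) - C y)) + real k * C k = (\<Sum>d<k. C d)"
  by (induction k) (auto simp: algebra_simps)

locale aoi_chain = refreshing_chain "states E" P "{XS} \<times> {..E}" p
  for E :: nat and P :: "state \<Rightarrow> state \<Rightarrow> real" and p :: "state \<Rightarrow> real"
begin

abbreviation "T \<equiv> Tmat E P"
abbreviation "I_T \<equiv> 1\<^sub>m (state_count E) - T"
abbreviation "\<rho> \<equiv> \<Sum>b\<le>E. p (XS, b)"

lemma sum_refresh: "(\<Sum>x\<in>{XS} \<times> {..E}. f x) = (\<Sum>b\<le>E. f (XS, b))"
  by (rule sum_Pair)

lemma rate_pos: "0 < \<rho>"
  using p_R_pos unfolding sum_refresh .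

lemma T_carrier [simp]: "T \<in> carrier_mat (state_count E) (state_count E)"
  by (simp add: Tmat_def state_count_def)

lemma T_dim [simp]: "dim_row T = state_count E" "dim_col T = state_count E"
  using T_carrier by (auto simp del: T_carrier)

lemma I_T_carrier: "I_T \<in> carrier_mat (state_count E) (state_count E)"
  by (intro minus_carrier_mat) simp

lemma avoid_eq: "avoid f s = (\<Sum>b\<le>E. P s (XF, b) * f (XF, b))"
proof -
  have "states E - {XS} \<times> {..E} = {XF} \<times> {..E}"
    unfolding states_eq by auto
  then show ?thesis unfolding avoid_def by (simp add: sum_Pair)
qed

text \<open>The columns of refresh states are zero, so the product keeps only non-refresh
  targets.\<close>

lemma T_mult_fvec: "T *\<^sub>v fvec E f = fvec E (avoid f)"
proof (rule eq_vecI)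
  fix i assume "i < dim_vec (fvec E (avoid f))"
  then have i: "i < state_count E" by (simp add: fvec_def)
  have "(T *\<^sub>v fvec E f) $ i = (\<Sum>j = 0..<state_count E. (if j \<le> E then 0 else P (idx_state E i) (XF, j - (E + 1))) * f (idx_state E j))"
    using i by (simp add: Tmat_def fvec_def scalar_prod_def state_count_def)
  also have "\<dots> = (\<Sum>j\<in>{E+1..<state_count E}. P (idx_state E i) (XF, j - (E + 1)) * f (XF, j - (E + 1)))"
    by (intro sum.mono_neutral_cong_right) (auto simp: idx_state_def state_count_def)
  also have "\<dots> = (\<Sum>b\<le>E. P (idx_state E i) (XF, b) * f (XF, b))"
    by (rule sum.reindex_bij_witness[of _ "\<lambda>b. E + 1 + b" "\<lambda>j. j - (E + 1)"]) (auto simp: state_count_def)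
  finally show "(T *\<^sub>v fvec E f) $ i = fvec E (avoid f) $ i"
    using i by (simp add: fvec_def avoid_eq)
qed (simp add: fvec_def)

lemma T_pow_mult_fvec: "(T ^\<^sub>m k) *\<^sub>v fvec E f = fvec E ((avoid ^^ k) f)"
proof (induction k arbitrary: f)
  case 0
  then show ?case by simp
next
  case (Suc k)
  have "(T ^\<^sub>m Suc k) *\<^sub>v fvec E f = (T ^\<^sub>m k) *\<^sub>v (T *\<^sub>v fvec E f)"
    by (simp add: assoc_mult_mat_vec[of _ "state_count E" "state_count E" _ "state_count E"])
  then show ?case unfolding T_mult_fvec Suc funpow_Suc_right o_def .
qed

lemma pSvec_scalar_prod: "scalar_prod (pSvec E p) (fvec E f) = (\<Sum>x\<in>{XS} \<times> {..E}. p x * f x) / \<rho>"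
proof -
  have "scalar_prod (pSvec E p) (fvec E f)
      = (\<Sum>i = 0..<state_count E. (if i \<le> E then p (XS, i) / \<rho> else 0) * f (idx_state E i))"
    by (simp add: pSvec_def fvec_def scalar_prod_def state_count_def)
  also have "\<dots> = (\<Sum>b\<le>E. p (XS, b) / \<rho> * f (XS, b))"
    by (intro sum.mono_neutral_cong_right) (auto simp: idx_state_def state_count_def)
  finally show ?thesis unfolding sum_refresh by (simp add: sum_divide_distrib)
qed

lemma avec_eq_fvec: "avec E P = fvec E (\<lambda>s. \<Sum>y\<in>{XS} \<times> {..E}. P s y)"
  unfolding avec_def fvec_def sum_refresh state_count_def ..

lemma I_T_mult_fvec: "I_T *\<^sub>v fvec E u = fvec E (\<lambda>s. u s - avoid u s)"
proof -
  have "I_T *\<^sub>v fvec E u = fvec E u - fvec E (avoid u)"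
    by (simp add: minus_mult_distrib_mat_vec[of _ "state_count E" "state_count E"] T_mult_fvec)
  also have "\<dots> = fvec E (\<lambda>s. u s - avoid u s)"
    unfolding fvec_def by (intro eq_vecI) auto
  finally show ?thesis .
qed

text \<open>A nonzero kernel vector of \<open>I - T\<close> would be a nonzero fixed point of
  \<open>avoid\<close>.\<close>

lemma invertible_I_T: "invertible_mat I_T"
proof -
  have "det I_T \<noteq> 0"
  proof
    assume "det I_T = 0"
    then obtain v where v: "v \<in> carrier_vec (state_count E)" "v \<noteq> 0\<^sub>v (state_count E)" "I_T *\<^sub>v v = 0\<^sub>v (state_count E)"
      using det_0_iff_vec_prod_zero_field[OF I_T_carrier] by blast
    obtain u where u: "v = fvec E u" using fvec_surj[OF v(1)] .
    have 0: "0\<^sub>v (state_count E) = fvec E (\<lambda>_. 0)" by (auto simp: fvec_def)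
    have "u s - avoid u s = 0" if "s \<in> states E" for s
      using v(3) unfolding u I_T_mult_fvec 0 by (rule fvec_inj) (rule that)
    then have "u s = 0" if "s \<in> states E" for s
      using that by (intro avoid_harmonic_eq_0[of u]) auto
    then have "v = 0\<^sub>v (state_count E)" unfolding u 0 by (rule fvec_cong)
    with v(2) show False by simp
  qed
  from det_non_zero_imp_unit[OF I_T_carrier this, where b="()"]
  obtain B where "B \<in> carrier_mat (state_count E) (state_count E)" "B * I_T = 1\<^sub>m (state_count E)" "I_T * B = 1\<^sub>m (state_count E)"
    unfolding Units_def ring_mat_simps by blast
  then show ?thesis using I_T_carrier by (auto simp: invertible_mat_def inverts_mat_def)
qed

lemma minv_carrier: "minv I_T \<in> carrier_mat (state_count E) (state_count E)"
  using minv_inverts(1)[OF invertible_I_T] I_T_carrier by simp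

text \<open>Translates the inverse matrix into the equation it solves state by state, the form
  needed for \<open>g\<close> and for the second solve.\<close>

lemma minv_mult_fvec:
  obtains u where "minv I_T *\<^sub>v fvec E f = fvec E u" "\<And>s. s \<in> states E \<Longrightarrow> u s = f s + avoid u s"
proof -
  have "minv I_T *\<^sub>v fvec E f \<in> carrier_vec (state_count E)"
    using minv_carrier by (rule mult_mat_vec_carrier) simp
  then obtain u where u: "minv I_T *\<^sub>v fvec E f = fvec E u" using fvec_surj by blast
  have "fvec E f = (I_T * minv I_T) *\<^sub>v fvec E f"
    using minv_inverts(2)[OF invertible_I_T] by simp
  also have "\<dots> = I_T *\<^sub>v fvec E u"
    unfolding u[symmetric] by (rule assoc_mult_mat_vec[OF I_T_carrier minv_carrier]) simp
  finally have "fvec E f = fvec E (\<lambda>s. u s - avoid u s)" unfolding I_T_mult_fvec .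
  from fvec_inj[OF this] have "u s = f s + avoid u s" if "s \<in> states E" for s using that by fastforce
  with u show thesis using that by blast
qed

end

locale aoi_chain_path = aoi_chain E P p + refreshing_chain_path "states E" P "{XS} \<times> {..E}" p M \<mu>0 X
  for E P p and M :: "'w measure" and \<mu>0 X
begin

lemma refresh_iff: "w \<in> space M \<Longrightarrow> refresh (\<lambda>s. X s w) s \<longleftrightarrow> X s w \<in> {XS} \<times> {..E}"
  using X_range[of w s] by (cases "X s w") (auto simp: refresh_def states_def)

text \<open>The ages are countably many, so all frequencies converge together outside a single null
  set.\<close>

lemma AE_aoi_path:
  assumes g: "\<And>s. s \<in> states E \<Longrightarrow> g s = 1 + avoid g s"
  shows "AE w in M. aoi_path (\<lambda>s. X s w) (\<lambda>s. age (hist s w)) \<rho> ((\<Sum>s\<in>states E. p s * g s) + 1)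
     (\<lambda>d. \<Sum>x\<in>{XS} \<times> {..E}. p x * (avoid ^^ d) (\<lambda>_. 1) x)
     (\<lambda>d. \<Sum>x\<in>{XS} \<times> {..E}. p x * (avoid ^^ d) (\<lambda>s. \<Sum>y\<in>{XS} \<times> {..E}. P s y) x)"
proof -
  let ?R = "{XS} \<times> {..E}"
  have R: "x \<in> states E" if "x \<in> ?R" for x using that R_subset by auto
  have rate: "AE w in M. cesaro (\<lambda>s. (\<lambda>x. of_bool (x \<in> ?R)) (X s w)) \<longlonglongrightarrow> (\<Sum>x\<in>states E. p x * of_bool (x \<in> ?R))"
    by (rule function_frequency)
  have rate_eq: "(\<Sum>x\<in>states E. p x * of_bool (x \<in> ?R)) = \<rho>"
    unfolding sum_refresh[of p, symmetric]
    by (rule sum.mono_neutral_cong_right[OF finite_S R_subset]) simp_all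
  have age: "AE w in M. \<forall>d. cesaro (\<lambda>s. of_bool (age (hist s w) = d + 2) * (\<lambda>_. 1) (X s w))
      \<longlonglongrightarrow> (\<Sum>x\<in>?R. p x * (avoid ^^ d) (step (\<lambda>_. 1)) x)"
    unfolding AE_all_countable by (intro allI age_frequency)
  have age_eq: "(\<Sum>x\<in>?R. p x * (avoid ^^ d) (step (\<lambda>_. 1)) x) = (\<Sum>x\<in>?R. p x * (avoid ^^ d) (\<lambda>_. 1) x)" for d
    by (intro sum.cong refl arg_cong2[where f="(*)"] avoid_funpow_cong[OF step_const R])
  have peak: "AE w in M. \<forall>d. cesaro (\<lambda>s. of_bool (age (hist s w) = d + 2) * (\<lambda>x. of_bool (x \<in> ?R)) (X s w))
      \<longlonglongrightarrow> (\<Sum>x\<in>?R. p x * (avoid ^^ d) (step (\<lambda>x. of_bool (x \<in> ?R))) x)"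
    unfolding AE_all_countable by (intro allI age_frequency)
  have "step (\<lambda>x. of_bool (x \<in> ?R)) s = (\<Sum>y\<in>?R. P s y)" for s
    using step_if[of "\<lambda>_. 1" "\<lambda>_. 0" s] by (simp add: of_bool_def)
  then have peak_eq: "step (\<lambda>x. of_bool (x \<in> ?R)) = (\<lambda>s. \<Sum>y\<in>?R. P s y)" by blast
  have mean: "AE w in M. cesaro (\<lambda>s. real (age (hist s w))) \<longlonglongrightarrow> (\<Sum>s\<in>states E. p s * g s) + 1"
    using g by (rule age_mean)
  show ?thesis using rate age peak mean AE_space
  proof eventually_elim
    case (elim w)
    show ?case
    proof
      show "2 \<le> age (hist 0 w)" by (rule age_ge_2)
      show "age (hist (Suc s) w) = (if refresh (\<lambda>s. X s w) s then 2 else Suc (age (hist s w)))" for s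
        unfolding age_hist_Suc refresh_iff[OF elim(5)] ..
      show "cesaro (\<lambda>s. of_bool (refresh (\<lambda>s. X s w) s)) \<longlonglongrightarrow> \<rho>"
        using elim(1) unfolding refresh_iff[OF elim(5)] rate_eq .
      show "cesaro (\<lambda>s. of_bool (age (hist s w) = d + 2)) \<longlonglongrightarrow> (\<Sum>x\<in>?R. p x * (avoid ^^ d) (\<lambda>_. 1) x)" for d
        using spec[OF elim(2), of d] unfolding age_eq mult_1_right .
      show "cesaro (\<lambda>s. of_bool (age (hist s w) = d + 2 \<and> refresh (\<lambda>s. X s w) s))
          \<longlonglongrightarrow> (\<Sum>x\<in>?R. p x * (avoid ^^ d) (\<lambda>s. \<Sum>y\<in>?R. P s y) x)" for d
        using spec[OF elim(3), of d] unfolding peak_eq refresh_iff[OF elim(5)] of_bool_conj .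
    qed (use elim(4) rate_pos in auto)
  qed
qed

end

theorem theorem2:
  fixes E :: nat and \<alpha> \<gamma> :: real and \<pi> :: "nat \<Rightarrow> nat \<Rightarrow> real" and \<omega> :: "nat \<Rightarrow> real"
    and p :: "state \<Rightarrow> real" and \<mu>0 :: "state \<Rightarrow> real"
    and M :: "'w measure" and X :: "nat \<Rightarrow> 'w \<Rightarrow> state"
  defines "P \<equiv> trans E \<alpha> \<gamma> \<pi> \<omega>"
  defines "n \<equiv> 2 * E + 2"
  defines "T \<equiv> Tmat E P" and "a \<equiv> avec E P" and "pS \<equiv> pSvec E p" and "one_n \<equiv> ones n"
  defines "D \<equiv> scalar_prod pS (minv (1\<^sub>m n - T) *\<^sub>v one_n)"
  assumes E: "E \<ge> 1"
    and \<alpha>: "0 < \<alpha>" "\<alpha> \<le> 1" and \<gamma>: "0 < \<gamma>" "\<gamma> \<le> 1"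
    and \<pi>_range: "\<And>b bt. b \<le> E \<Longrightarrow> bt \<le> b \<Longrightarrow> 0 \<le> \<pi> b bt \<and> \<pi> b bt \<le> 1"
    and \<pi>_sum: "\<And>b. b \<le> E \<Longrightarrow> (\<Sum>bt\<le>b. \<pi> b bt) = 1"
    and \<pi>_zero: "\<And>b bt. bt > b \<Longrightarrow> \<pi> b bt = 0"
    and \<omega>_range: "\<And>bt. bt \<le> E \<Longrightarrow> 0 \<le> \<omega> bt \<and> \<omega> bt \<le> 1"
    and p_stat: "stationary E P p"
    and p_unique: "\<And>q. stationary E P q \<Longrightarrow> \<forall>s\<in>states E. q s = p s"
    and pS_pos: "(\<Sum>b\<le>E. p (XS, b)) > 0"
    and M: "prob_space M"
    and X_meas: "\<And>s. X s \<in> measurable M (count_space UNIV)"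
    and X_range: "\<And>s w. w \<in> space M \<Longrightarrow> X s w \<in> states E"
    and X_markov: "\<And>m xs. length xs = Suc m \<Longrightarrow> set xs \<subseteq> states E \<Longrightarrow>
        measure M {w \<in> space M. \<forall>k\<le>m. X k w = xs ! k}
          = \<mu>0 (xs ! 0) * (\<Prod>k<m. P (xs ! k) (xs ! Suc k))"
  shows "invertible_mat (1\<^sub>m n - T) \<and>
    (AE w in M.
      (\<forall>\<delta>\<ge>2. disc_frac (\<lambda>s. X s w) \<delta> \<longlonglongrightarrow>
           (scalar_prod pS ((T ^\<^sub>m (\<delta> - 2)) *\<^sub>v one_n)) / D) \<and>
      (\<forall>\<delta>\<ge>2. peak_frac (\<lambda>s. X s w) \<delta> \<longlonglongrightarrow>
           scalar_prod pS ((T ^\<^sub>m (\<delta> - 2)) *\<^sub>v a)) \<and>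
      ((avg_aoi (\<lambda>s. X s w) \<longlongrightarrow>
           1/2 + (scalar_prod pS ((minv (1\<^sub>m n - T) * minv (1\<^sub>m n - T)) *\<^sub>v one_n)) / D) at_top) \<and>
      (\<forall>\<theta>::nat\<ge>1. (viol_frac (\<lambda>s. X s w) (real \<theta>) \<longlongrightarrow>
           1 - ((\<Sum>y=1..\<theta>-1. real y * (scalar_prod pS ((T ^\<^sub>m (y - 1)) *\<^sub>v a)))
                 + real (\<theta> - 1) * (scalar_prod pS ((T ^\<^sub>m (\<theta> - 1)) *\<^sub>v one_n))) / D) at_top))"
proof -
  interpret policy E \<alpha> \<gamma> \<pi> \<omega>
    by unfold_locales (fact \<alpha> \<gamma> \<pi>_range \<pi>_sum \<pi>_zero \<omega>_range)+
  interpret prob_space M by (rule M)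
  let ?R = "{XS} \<times> {..E}"
  have n: "n = state_count E" by (simp add: n_def state_count_def)
  interpret chain: aoi_chain_path E P p M \<mu>0 X
  proof
    show "finite (states E)" by (rule finite_states)
    show "?R \<subseteq> states E" by (auto simp: states_def)
    show "0 \<le> P s' s" if "s' \<in> states E" "s \<in> states E" for s' s
      unfolding P_def using that by (rule trans_nonneg)
    show "(\<Sum>s\<in>states E. P s' s) = 1" if "s' \<in> states E" for s'
      unfolding P_def using that by (rule trans_sum)
    show "(\<Sum>s\<in>states E. p s) = 1" using p_stat unfolding stationary_def by blast
    show "p s = (\<Sum>s'\<in>states E. p s' * P s' s)" if "s \<in> states E" for s
      using p_stat that unfolding stationary_def by blast
    show "q s = p s"
      if "\<And>s. s \<in> states E \<Longrightarrow> 0 \<le> q s" "(\<Sum>s\<in>states E. q s) = 1"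
        "\<And>s. s \<in> states E \<Longrightarrow> q s = (\<Sum>s'\<in>states E. q s' * P s' s)" "s \<in> states E" for q s
      using p_unique[of q] that unfolding stationary_def by blast
    show "0 < (\<Sum>x\<in>?R. p x)" using pS_pos unfolding sum_Pair .
  qed (fact X_meas X_range X_markov)+
  let ?\<rho> = "\<Sum>b\<le>E. p (XS, b)"
  have \<rho>: "?\<rho> \<noteq> 0" using pS_pos by simp
  define c where "c d = (\<Sum>x\<in>?R. p x * (chain.avoid ^^ d) (\<lambda>_. 1) x)" for d
  define e where "e d = (\<Sum>x\<in>?R. p x * (chain.avoid ^^ d) (\<lambda>s. \<Sum>y\<in>?R. P s y) x)" for d
  have one: "one_n = fvec E (\<lambda>_. 1)" unfolding one_n_def n by (rule ones_eq_fvec)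
  obtain g where g: "minv (1\<^sub>m n - T) *\<^sub>v one_n = fvec E g"
    "\<And>s. s \<in> states E \<Longrightarrow> g s = 1 + chain.avoid g s"
    unfolding one n T_def using chain.minv_mult_fvec[of "\<lambda>_. 1"] by blast
  \<comment> \<open>The second power of the inverse: \<open>h\<close> solves the equation driven by
    \<open>g\<close>, and balancing it against \<open>p\<close> yields the stationary mean of
    \<open>g\<close>.\<close>
  obtain h where h: "minv (1\<^sub>m n - T) *\<^sub>v fvec E g = fvec E h"
    "\<And>s. s \<in> states E \<Longrightarrow> h s = g s + chain.avoid h s"
    unfolding n T_def using chain.minv_mult_fvec[of g] by blast
  have D: "D = 1 / ?\<rho>"
    unfolding D_def g(1) pS_def chain.pSvec_scalar_prod
    using chain.sum_refresh_eq_sum_stationary[of g "\<lambda>_. 1", OF g(2)] chain.p_sum by simp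
  have c: "scalar_prod pS ((T ^\<^sub>m d) *\<^sub>v one_n) = c d / ?\<rho>" for d
    unfolding pS_def T_def one chain.T_pow_mult_fvec chain.pSvec_scalar_prod c_def ..
  have e: "scalar_prod pS ((T ^\<^sub>m d) *\<^sub>v a) = e d / ?\<rho>" for d
    unfolding pS_def T_def a_def chain.avec_eq_fvec chain.T_pow_mult_fvec chain.pSvec_scalar_prod e_def ..
  \<comment> \<open>Since \<open>a = (I - T) 1\<close> and \<open>avoid\<close> is linear, the peak
    law is the decrement of the survival sequence.\<close>
  have e_c: "e d = c d - c (Suc d)" for d
  proof -
    have "(chain.avoid ^^ d) (\<lambda>s. \<Sum>y\<in>?R. P s y) x = (chain.avoid ^^ d) (\<lambda>s. 1 - chain.avoid (\<lambda>_. 1) s) x"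
      if "x \<in> states E" for x
      by (rule chain.avoid_funpow_cong[OF chain.sum_R_eq_one_minus_avoid that])
    then have "e d = (\<Sum>x\<in>?R. p x * (chain.avoid ^^ d) (\<lambda>s. 1 - chain.avoid (\<lambda>_. 1) s) x)"
      unfolding e_def using chain.R_subset by (intro sum.cong) auto
    then show ?thesis
      unfolding c_def chain.avoid_funpow_diff funpow_Suc_right o_def
      by (simp add: right_diff_distrib sum_subtractf)
  qed
  have mean: "scalar_prod pS ((minv (1\<^sub>m n - T) * minv (1\<^sub>m n - T)) *\<^sub>v one_n) / D = (\<Sum>s\<in>states E. p s * g s)"
  proof -
    have minv: "minv (1\<^sub>m n - T) \<in> carrier_mat (state_count E) (state_count E)"
      unfolding n T_def by (rule chain.minv_carrier)
    have "(minv (1\<^sub>m n - T) * minv (1\<^sub>m n - T)) *\<^sub>v one_n = fvec E h"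
      unfolding h(1)[symmetric] g(1)[symmetric]
      by (rule assoc_mult_mat_vec[OF minv minv]) (simp add: one)
    then show ?thesis
      unfolding pS_def using chain.sum_refresh_eq_sum_stationary[of h g, OF h(2)] \<rho>
      by (simp add: chain.pSvec_scalar_prod D)
  qed
  have viol: "((\<Sum>y=1..\<theta>-1. real y * (scalar_prod pS ((T ^\<^sub>m (y - 1)) *\<^sub>v a)))
        + real (\<theta> - 1) * (scalar_prod pS ((T ^\<^sub>m (\<theta> - 1)) *\<^sub>v one_n))) / D = (\<Sum>d<\<theta> - 1. c d)" for \<theta>
  proof -
    have "(\<Sum>y=1..\<theta>-1. real y * (scalar_prod pS ((T ^\<^sub>m (y - 1)) *\<^sub>v a))) = (\<Sum>y=1..\<theta>-1. real y * (c (y - 1) - c y)) / ?\<rho>"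
      unfolding e e_c sum_divide_distrib by (intro sum.cong) auto
    then show ?thesis
      unfolding c D truncated_mean_telescopes[of c "\<theta> - 1", symmetric] using \<rho>
      by (simp add: field_simps)
  qed
  have "AE w in M. aoi_path (\<lambda>s. X s w) (\<lambda>s. chain.age (chain.hist s w)) ?\<rho> ((\<Sum>s\<in>states E. p s * g s) + 1) c e"
    unfolding c_def[abs_def] e_def[abs_def] using g(2) by (rule chain.AE_aoi_path)
  then have "AE w in M.
      (\<forall>\<delta>\<ge>2. disc_frac (\<lambda>s. X s w) \<delta> \<longlonglongrightarrow>
           (scalar_prod pS ((T ^\<^sub>m (\<delta> - 2)) *\<^sub>v one_n)) / D) \<and>
      (\<forall>\<delta>\<ge>2. peak_frac (\<lambda>s. X s w) \<delta> \<longlonglongrightarrow>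
           scalar_prod pS ((T ^\<^sub>m (\<delta> - 2)) *\<^sub>v a)) \<and>
      ((avg_aoi (\<lambda>s. X s w) \<longlongrightarrow>
           1/2 + (scalar_prod pS ((minv (1\<^sub>m n - T) * minv (1\<^sub>m n - T)) *\<^sub>v one_n)) / D) at_top) \<and>
      (\<forall>\<theta>::nat\<ge>1. (viol_frac (\<lambda>s. X s w) (real \<theta>) \<longlongrightarrow>
           1 - ((\<Sum>y=1..\<theta>-1. real y * (scalar_prod pS ((T ^\<^sub>m (y - 1)) *\<^sub>v a)))
                 + real (\<theta> - 1) * (scalar_prod pS ((T ^\<^sub>m (\<theta> - 1)) *\<^sub>v one_n))) / D) at_top)"
  proof eventually_elim
    case (elim w)
    interpret path: aoi_path "\<lambda>s. X s w" "\<lambda>s. chain.age (chain.hist s w)" ?\<rho> "(\<Sum>s\<in>states E. p s * g s) + 1" c e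
      by (rule elim)
    show ?case unfolding viol mean unfolding c e
    proof (intro conjI allI impI)
      fix \<delta> :: nat assume "2 \<le> \<delta>"
      then obtain d where d: "\<delta> = d + 2" by (metis add.commute le_Suc_ex)
      show "disc_frac (\<lambda>s. X s w) \<delta> \<longlonglongrightarrow> c (\<delta> - 2) / ?\<rho> / D"
        using path.disc_frac_tendsto[of d] \<rho> by (simp add: d D)
      show "peak_frac (\<lambda>s. X s w) \<delta> \<longlonglongrightarrow> e (\<delta> - 2) / ?\<rho>"
        using path.peak_frac_tendsto[of d] by (simp add: d)
    next
      \<comment> \<open>The path limit is \<open>m - 1/2\<close> with \<open>m\<close> the
        stationary mean of \<open>g\<close> plus 1.\<close>
      show "(avg_aoi (\<lambda>s. X s w) \<longlongrightarrow> 1/2 + (\<Sum>s\<in>states E. p s * g s)) at_top"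
        using path.avg_aoi_tendsto by (simp add: add.commute)
    next
      fix \<theta> :: nat assume "1 \<le> \<theta>"
      then show "(viol_frac (\<lambda>s. X s w) (real \<theta>) \<longlongrightarrow> 1 - (\<Sum>d<\<theta> - 1. c d)) at_top"
        by (rule path.viol_frac_tendsto)
    qed
  qed
  moreover have "invertible_mat (1\<^sub>m n - T)"
    unfolding n T_def by (rule chain.invertible_I_T)
  ultimately show ?thesis by blast
qed

end
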